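(* Assume Assumption 1 (stated in the context) holds and that $d_\lambda^n<n$ for every $n$. Then for any $\lambda>0$, \[\mathbb{E}\left[\left(\frac{1}{1-\frac{d_\lambda^n}{n}}\hat\Sigma_n+\lambda I\right)^{-1}\right]=(\Sigma_n+\lambda I)^{-1}+\Omega_0,\] where the matrix $\Omega_0=\Omega_0(n)$ satisfies $\|\Omega_0\|\to 0$ as $n,d\to\infty$, $d/n\to y\in[0,1)$.
   Context: Asymptotic framework: a sequence of problems indexed by $n$, with dimension $d=d(n)$, $n,d\to\infty$ and $d/n\to y\in[0,1)$. For each $n$, $x\in\mathbb{R}^d$ is a random vector with $\mathbb{E}[x]=0$, $\mathrm{Cov}(x)=\Sigma_n\in\mathbb{R}^{d\times d}$; $x_1,\dots,x_n$ are i.i.d. copies of $x$ (the rows of the data matrix) and $\hat\Sigma_n=\frac1n\sum_{i=1}^n x_ix_i^T$. For $\lambda>0$, $d_\lambda^n=\mathrm{tr}(\Sigma_n(\Sigma_n+\lambda I)^{-1})$ (effective dimension). The empirical spectral distribution of $\Sigma_n$ is $F_{\Sigma_n}(u)=d^{-1}\sum_{i=1}^d\mathbb{I}(\lambda_i\le u)$, $\lambda_i$ the eigenvalues of $\Sigma_n$. Let $M=\sup_{\|e\|=1}\mathbb{E}(e^Tx)^4$ and $\nu=\sup_{\|\Omega\|=1}\mathrm{Var}(x^T\Omega x/d)$. Assumption 1: (A1) $F_{\Sigma_n}(u)\to F_\Sigma(u)$ almost surely for almost every $u\ge0$, for some limiting distribution $F_\Sigma$; (A2) $M<\infty$ and $\nu\to0$;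 (A3) the eigenvalues of each $\Sigma_n$ lie in $[\sigma_{\min},\sigma_{\max}]$ with $\sigma_{\min}>0$ and $\sigma_{\max}$ not depending on $n$. $\|\cdot\|$ denotes the spectral norm. *)

theory Defs
  imports "HOL-Probability.Probability" "Jordan_Normal_Form.Matrix"
    "Jordan_Normal_Form.Char_Poly" "Jordan_Normal_Form.Gauss_Jordan_Elimination"
begin

definition vnorm :: "real vec \<Rightarrow> real" where
  "vnorm v = sqrt (v \<bullet> v)"

definition spec_norm :: "real mat \<Rightarrow> real" where
  "spec_norm A = Sup {vnorm (A *\<^sub>v v) | v. v \<in> carrier_vec (dim_col A) \<and> vnorm v = 1}"

definition minv :: "real mat \<Rightarrow> real mat" where
  "minv A = the (mat_inverse A)"

definition mtrace :: "real mat \<Rightarrow> real" where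
  "mtrace A = (\<Sum>i<dim_row A. A $$ (i, i))"

definition esd :: "real mat \<Rightarrow> real \<Rightarrow> real" where
  "esd A u = (\<Sum>k\<in>{k. poly (char_poly A) k = 0 \<and> k \<le> u}. real (order k (char_poly A)))
              / real (dim_row A)"

definition eff_dim :: "real mat \<Rightarrow> real \<Rightarrow> real" where
  "eff_dim S lam = mtrace (S * minv (S + lam \<cdot>\<^sub>m 1\<^sub>m (dim_row S)))"

definition sample_cov :: "nat \<Rightarrow> nat \<Rightarrow> (nat \<Rightarrow> nat \<Rightarrow> real) \<Rightarrow> real mat" where
  "sample_cov d n xs = mat d d (\<lambda>(j, k). (\<Sum>i<n. xs i j * xs i k) / real n)"

definition mat_expectation :: "'a measure \<Rightarrow> nat \<Rightarrow> ('a \<Rightarrow> real mat) \<Rightarrow> real mat" where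
  "mat_expectation M d F = mat d d (\<lambda>(j, k). \<integral>\<omega>. F \<omega> $$ (j, k) \<partial>M)"

abbreviation vecspace :: "nat \<Rightarrow> (nat \<Rightarrow> real) measure" where
  "vecspace d \<equiv> PiM {..<d} (\<lambda>_. borel)"

end

(*
Write D = d_lambda / n, c = 1 / (1 - D), R for the ridge resolvent of the rescaled sample covariance,
R_i for the resolvent with x_i left out, B = (Sigma + lambda)^-1, alpha_i = x_i^T R_i x_i / n and
g = tr(Sigma R) / n.  The rank-one identity R x_i = R_i x_i / (1 + c alpha_i) gives

  u^T (R - B) v = u^T R Sigma B v - (1/n) sum_i c (u^T R_i x_i) (x_i^T B v) / (1 + c alpha_i).

Since x_i is independent of R_i, the right-hand side averages to almost zero as soon as
c / (1 + c alpha_i) is close to 1, that is, alpha_i is close to D.  By (A2) alpha_i is close to g in L^2.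
Tracing the same expansion against Sigma gives (g - D) (1 + c (g - T)) = (1 + c g) * o(1) in L^1, where
T = tr(B Sigma R Sigma) / n and T <= g, so g is close to D.  No concentration inequality for g
around its mean is needed: the trace equation itself pins g down.
*)
theory Submission
  imports Defs "Jordan_Normal_Form.Determinant"
begin

text \<open>The rescaling is tuned so that 1 + c D = c. Hence c / (1 + c alpha) equals 1 exactly at
  alpha = D, and the same identity cancels the T-term that would otherwise survive in the traced
  equation. What remains there is the factor 1 + c (g - T), which is at least 1 once T <= g, so it
  can be divided out.

  The obstacle is that every constant must be free of n. Removing one observation costs O(1/n)
  because c is absorbed by c alpha / (1 + c alpha) <= 1. The norm of Sigma is controlled by 1 + m,
  where m bounds the fourth moments. The factor c itself is bounded because D <= d / n, and d / n is
  eventually below the midpoint (1 + y) / 2. For each large n the outcome is one explicit bound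
  \<open>err\<close>, monotone in c and vanishing with sqrt nu and 1 / n. It holds for every pair of
  unit vectors u, v at once, which makes it a bound on the spectral norm.\<close>

unbundle no inner_syntax and no vec_syntax

section \<open>Norms, traces and ridge inverses\<close>

lemma scalar_prod_self: "(v::real vec) \<bullet> v = (\<Sum>i<dim_vec v. (v $ i)\<^sup>2)"
  by (simp add: scalar_prod_def atLeast0LessThan power2_eq_square)

lemma scalar_prod_self_nonneg: "0 \<le> (v::real vec) \<bullet> v"
  by (simp add: scalar_prod_self sum_nonneg)

lemma vnorm_nonneg [simp]: "0 \<le> vnorm v"
  by (simp add: vnorm_def scalar_prod_self_nonneg)

lemma vnorm_sq: "(vnorm v)\<^sup>2 = v \<bullet> v"
  by (simp add: vnorm_def scalar_prod_self_nonneg)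

lemma vnorm_L2: "vnorm v = L2_set (\<lambda>i. v $ i) {..<dim_vec v}"
  by (simp add: vnorm_def L2_set_def scalar_prod_self)

lemma scalar_prod_abs_le:
  assumes "u \<in> carrier_vec d" "v \<in> carrier_vec d"
  shows "\<bar>u \<bullet> v\<bar> \<le> vnorm u * vnorm v"
proof -
  have "\<bar>u \<bullet> v\<bar> \<le> (\<Sum>i<d. \<bar>u $ i\<bar> * \<bar>v $ i\<bar>)"
    using assms by (simp add: scalar_prod_def atLeast0LessThan abs_mult[symmetric])
  also have "\<dots> \<le> vnorm u * vnorm v"
    using assms L2_set_mult_ineq[of "\<lambda>i. u $ i" "\<lambda>i. v $ i" "{..<d}"] by (simp add: vnorm_L2)
  finally show ?thesis .
qed

lemma vnorm_smult [simp]: "vnorm (a \<cdot>\<^sub>v v) = \<bar>a\<bar> * vnorm v"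
proof -
  have "(a \<cdot>\<^sub>v v) \<bullet> (a \<cdot>\<^sub>v v) = a\<^sup>2 * (v \<bullet> v)"
    unfolding scalar_prod_self by (simp add: power_mult_distrib sum_distrib_left)
  then show ?thesis by (simp add: vnorm_def real_sqrt_mult)
qed

lemma vnorm_eq_0_iff: "v \<in> carrier_vec d \<Longrightarrow> vnorm v = 0 \<longleftrightarrow> v = 0\<^sub>v d"
  by (auto simp: vnorm_L2 L2_set_eq_0_iff intro!: eq_vecI)

lemma vnorm_unit_vec [simp]: "i < d \<Longrightarrow> vnorm (unit_vec d i) = 1"
  by (simp add: vnorm_def)

lemma unit_vec_bilinear:
  "A \<in> carrier_mat d d \<Longrightarrow> j < d \<Longrightarrow> k < d \<Longrightarrow> unit_vec d j \<bullet> (A *\<^sub>v unit_vec d k) = (A $$ (j, k) :: real)"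
  by simp

lemma vec_normalize:
  assumes "v \<in> carrier_vec d" "vnorm v \<noteq> 0"
  obtains e where "e \<in> carrier_vec d" "vnorm e = 1" "v = vnorm v \<cdot>\<^sub>v e"
proof
  show "(1 / vnorm v) \<cdot>\<^sub>v v \<in> carrier_vec d" "vnorm ((1 / vnorm v) \<cdot>\<^sub>v v) = 1"
    "v = vnorm v \<cdot>\<^sub>v ((1 / vnorm v) \<cdot>\<^sub>v v)"
    using assms by (auto intro!: eq_vecI)
qed

section \<open>Operator norm bounds and the spectral norm\<close>

text \<open>Upper bounds stand in for the supremum \<open>spec_norm\<close>: they compose under
  products and raise no question of nonempty or bounded sets.\<close>

definition op_bound :: "nat \<Rightarrow> real mat \<Rightarrow> real \<Rightarrow> bool" where
  "op_bound d A K \<longleftrightarrow> A \<in> carrier_mat d d \<and> 0 \<le> K \<and>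
     (\<forall>v\<in>carrier_vec d. vnorm (A *\<^sub>v v) \<le> K * vnorm v)"

lemma op_boundD:
  assumes "op_bound d A K"
  shows "A \<in> carrier_mat d d" "0 \<le> K" "v \<in> carrier_vec d \<Longrightarrow> vnorm (A *\<^sub>v v) \<le> K * vnorm v"
  using assms by (auto simp: op_bound_def)

lemma op_bound_mult:
  assumes A: "op_bound d A K" and B: "op_bound d B L"
  shows "op_bound d (A * B) (K * L)"
  unfolding op_bound_def
proof (intro conjI ballI)
  fix v :: "real vec" assume v: "v \<in> carrier_vec d"
  have "vnorm (A *\<^sub>v (B *\<^sub>v v)) \<le> K * vnorm (B *\<^sub>v v)"
    using op_boundD[OF A] op_boundD[OF B] v by auto
  also have "\<dots> \<le> K * (L * vnorm v)"
    using op_boundD[OF A] op_boundD[OF B] v by (intro mult_left_mono) auto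
  finally show "vnorm (A * B *\<^sub>v v) \<le> K * L * vnorm v"
    using op_boundD(1)[OF A] op_boundD(1)[OF B] v by (simp add: assoc_mult_mat_vec[of _ d d _ d])
qed (use op_boundD[OF A] op_boundD[OF B] in auto)

lemma op_bound_bilinear:
  assumes A: "op_bound d A K" and "u \<in> carrier_vec d" "v \<in> carrier_vec d"
  shows "\<bar>u \<bullet> (A *\<^sub>v v)\<bar> \<le> K * vnorm u * vnorm v"
proof -
  have "\<bar>u \<bullet> (A *\<^sub>v v)\<bar> \<le> vnorm u * vnorm (A *\<^sub>v v)"
    using op_boundD(1)[OF A] assms by (intro scalar_prod_abs_le[of _ d]) auto
  also have "\<dots> \<le> vnorm u * (K * vnorm v)"
    using op_boundD(3)[OF A] assms by (intro mult_left_mono) auto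
  finally show ?thesis by (simp add: ac_simps)
qed

text \<open>With u in the direction of A v, the value u . A v is the norm of A v. So estimates for
  fixed unit vectors, uniform in them, suffice for the operator norm.\<close>

lemma op_bound_of_bilinear:
  assumes A: "A \<in> carrier_mat d d" and K: "0 \<le> K"
    and le: "\<And>u v. u \<in> carrier_vec d \<Longrightarrow> v \<in> carrier_vec d \<Longrightarrow> vnorm u = 1 \<Longrightarrow> vnorm v = 1 \<Longrightarrow>
      \<bar>u \<bullet> (A *\<^sub>v v)\<bar> \<le> K"
  shows "op_bound d A K"
  unfolding op_bound_def
proof (intro conjI ballI A K)
  fix v :: "real vec" assume v: "v \<in> carrier_vec d"
  show "vnorm (A *\<^sub>v v) \<le> K * vnorm v"
  proof (cases "vnorm v = 0 \<or> vnorm (A *\<^sub>v v) = 0")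
    case True
    have "A *\<^sub>v 0\<^sub>v d = 0\<^sub>v d" using A by (auto intro!: eq_vecI)
    moreover have "vnorm (0\<^sub>v d) = 0" by (simp add: vnorm_eq_0_iff[of _ d])
    ultimately show ?thesis using True vnorm_eq_0_iff[OF v] K by auto
  next
    case False
    have Av: "A *\<^sub>v v \<in> carrier_vec d" using A v by auto
    obtain e where e: "e \<in> carrier_vec d" "vnorm e = 1" "v = vnorm v \<cdot>\<^sub>v e"
      using vec_normalize[OF v] False by auto
    obtain u where u: "u \<in> carrier_vec d" "vnorm u = 1" "A *\<^sub>v v = vnorm (A *\<^sub>v v) \<cdot>\<^sub>v u"
      using vec_normalize[OF Av] False by auto
    have "u \<bullet> (A *\<^sub>v v) = u \<bullet> (vnorm (A *\<^sub>v v) \<cdot>\<^sub>v u)" using u(3) by simp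
    also have "\<dots> = vnorm (A *\<^sub>v v)"
      using u(1,2) vnorm_sq[of u] by simp
    finally have "vnorm (A *\<^sub>v v) = \<bar>u \<bullet> (A *\<^sub>v (vnorm v \<cdot>\<^sub>v e))\<bar>" using e(3) by simp
    also have "A *\<^sub>v (vnorm v \<cdot>\<^sub>v e) = vnorm v \<cdot>\<^sub>v (A *\<^sub>v e)"
      using A e(1) by (simp add: mult_mat_vec)
    also have "\<bar>u \<bullet> (vnorm v \<cdot>\<^sub>v (A *\<^sub>v e))\<bar> = vnorm v * \<bar>u \<bullet> (A *\<^sub>v e)\<bar>"
      using u(1) e(1) A by (subst scalar_prod_smult_right) (auto simp: abs_mult)
    also have "\<dots> \<le> vnorm v * K" using le[OF u(1) e(1) u(2) e(2)] by (intro mult_left_mono) auto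
    finally show ?thesis by (simp add: mult.commute)
  qed
qed

lemma smult_mat_mult_vec:
  "A \<in> carrier_mat nr nc \<Longrightarrow> v \<in> carrier_vec nc \<Longrightarrow> (a \<cdot>\<^sub>m A) *\<^sub>v v = a \<cdot>\<^sub>v (A *\<^sub>v (v::real vec))"
  by (intro eq_vecI) (auto simp: scalar_prod_def sum_distrib_left ac_simps)

text \<open>For 0 < d a unit vector makes the set under \<open>Sup\<close> nonempty, and the given
  bound K makes it bounded above, so the supremum is a genuine least upper bound.\<close>

lemma spec_norm_props:
  assumes A: "op_bound d A K" and d: "0 < d"
  shows spec_norm_le: "spec_norm A \<le> K" and spec_norm_nonneg: "0 \<le> spec_norm A"
    and op_bound_spec_norm: "op_bound d A (spec_norm A)"
proof -
  let ?S = "{vnorm (A *\<^sub>v v) | v. v \<in> carrier_vec (dim_col A) \<and> vnorm v = 1}"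
  have dc: "dim_col A = d" using op_boundD(1)[OF A] by auto
  have mem: "vnorm (A *\<^sub>v unit_vec d 0) \<in> ?S" using d by (auto simp: dc)
  have ub: "s \<le> K" if "s \<in> ?S" for s using that op_boundD(3)[OF A] by (force simp: dc)
  show "spec_norm A \<le> K" unfolding spec_norm_def using mem ub by (intro cSup_least) auto
  have bdd: "bdd_above ?S" using ub by (rule bdd_aboveI)
  have up: "s \<le> spec_norm A" if "s \<in> ?S" for s
    unfolding spec_norm_def using that bdd by (rule cSup_upper)
  show nonneg: "0 \<le> spec_norm A" using up[OF mem] vnorm_nonneg order_trans by blast
  show "op_bound d A (spec_norm A)"
  proof (rule op_bound_of_bilinear[OF op_boundD(1)[OF A] nonneg])
    fix u v :: "real vec"
    assume u: "u \<in> carrier_vec d" "vnorm u = 1" and v: "v \<in> carrier_vec d" "vnorm v = 1"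
    have "\<bar>u \<bullet> (A *\<^sub>v v)\<bar> \<le> vnorm u * vnorm (A *\<^sub>v v)"
      using op_boundD(1)[OF A] u v by (intro scalar_prod_abs_le[of _ d]) auto
    also have "\<dots> \<le> spec_norm A" using up v u by (auto simp: dc)
    finally show "\<bar>u \<bullet> (A *\<^sub>v v)\<bar> \<le> spec_norm A" .
  qed
qed

text \<open>The bound for a scaled matrix gives one inequality; scaling back by 1 / a gives the
  other. It serves to normalise a matrix to spectral norm 1, the only case that (A2)
  addresses.\<close>

lemma spec_norm_smult:
  assumes A: "op_bound d A K" and d: "0 < d" and a: "0 < a"
  shows "spec_norm (a \<cdot>\<^sub>m A) = a * spec_norm A"
proof -
  have bd: "op_bound d (b \<cdot>\<^sub>m B) (b * L)" if "op_bound d B L" "0 < b" for b B L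
    unfolding op_bound_def
  proof (intro conjI ballI)
    fix v :: "real vec" assume v: "v \<in> carrier_vec d"
    have "vnorm (b \<cdot>\<^sub>m B *\<^sub>v v) = b * vnorm (B *\<^sub>v v)"
      using op_boundD(1)[OF that(1)] v that(2) by (simp add: smult_mat_mult_vec[of _ d d])
    also have "\<dots> \<le> b * (L * vnorm v)"
      using op_boundD(3)[OF that(1) v] that(2) by (intro mult_left_mono) auto
    finally show "vnorm (b \<cdot>\<^sub>m B *\<^sub>v v) \<le> b * L * vnorm v" by simp
  qed (use op_boundD[OF that(1)] that(2) in auto)
  note A' = op_bound_spec_norm[OF A d]
  have 1: "spec_norm (a \<cdot>\<^sub>m A) \<le> a * spec_norm A" by (rule spec_norm_le[OF bd[OF A' a] d])
  have "(1 / a) \<cdot>\<^sub>m (a \<cdot>\<^sub>m A) = A" using a by (auto intro!: eq_matI)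
  then have "spec_norm A \<le> 1 / a * spec_norm (a \<cdot>\<^sub>m A)"
    using spec_norm_le[OF bd[OF op_bound_spec_norm[OF bd[OF A a] d], of "1 / a"] d] a by simp
  with 1 a show ?thesis by (simp add: field_simps)
qed

section \<open>Symmetric positive semidefinite matrices and their ridge resolvents\<close>

definition psd_mat :: "nat \<Rightarrow> real mat \<Rightarrow> bool" where
  "psd_mat d S \<longleftrightarrow> S \<in> carrier_mat d d \<and>
     (\<forall>u\<in>carrier_vec d. \<forall>v\<in>carrier_vec d. u \<bullet> (S *\<^sub>v v) = (S *\<^sub>v u) \<bullet> v) \<and>
     (\<forall>v\<in>carrier_vec d. 0 \<le> v \<bullet> (S *\<^sub>v v))"

text \<open>One locale serves the population resolvent as well as the resolvents of full and
  leave-one-out samples.\<close>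

locale ridge =
  fixes d :: nat and S :: "real mat" and lam :: real
  assumes psd: "psd_mat d S" and lam: "0 < lam"
begin

abbreviation "A \<equiv> S + lam \<cdot>\<^sub>m 1\<^sub>m d"
abbreviation "R \<equiv> minv A"

lemma S_carrier [simp]: "S \<in> carrier_mat d d"
  and S_sym: "u \<in> carrier_vec d \<Longrightarrow> v \<in> carrier_vec d \<Longrightarrow> u \<bullet> (S *\<^sub>v v) = (S *\<^sub>v u) \<bullet> v"
  and S_nonneg: "v \<in> carrier_vec d \<Longrightarrow> 0 \<le> v \<bullet> (S *\<^sub>v v)"
  using psd by (auto simp: psd_mat_def)

lemma Sv_carrier [simp]: "S *\<^sub>v v \<in> carrier_vec d"
  by (rule carrier_vecI) (use carrier_matD(1)[OF S_carrier] in simp)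

lemma A_carrier [simp]: "A \<in> carrier_mat d d"
  by simp

lemma A_mult: "v \<in> carrier_vec d \<Longrightarrow> A *\<^sub>v v = S *\<^sub>v v + lam \<cdot>\<^sub>v v"
  by (simp add: add_mult_distrib_mat_vec[of _ d d] smult_mat_mult_vec[of _ d d])

lemma scalar_prod_A:
  "u \<in> carrier_vec d \<Longrightarrow> v \<in> carrier_vec d \<Longrightarrow> u \<bullet> (A *\<^sub>v v) = u \<bullet> (S *\<^sub>v v) + lam * (u \<bullet> v)"
  by (simp add: A_mult scalar_prod_add_distrib[of _ d])

lemma A_lower: "v \<in> carrier_vec d \<Longrightarrow> lam * (vnorm v)\<^sup>2 \<le> v \<bullet> (A *\<^sub>v v)"
  using S_nonneg[of v] by (simp add: scalar_prod_A vnorm_sq)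

lemma det_A: "det A \<noteq> 0"
proof
  assume "det A = 0"
  then obtain v where v: "v \<in> carrier_vec d" "v \<noteq> 0\<^sub>v d" "A *\<^sub>v v = 0\<^sub>v d"
    using det_0_iff_vec_prod_zero_field[OF A_carrier] by auto
  then have "lam * (vnorm v)\<^sup>2 \<le> 0" using A_lower[OF v(1)] by simp
  then have "vnorm v = 0" using lam by (simp add: mult_le_0_iff)
  with v vnorm_eq_0_iff show False by blast
qed

text \<open>\<open>minv\<close> is \<open>the\<close> of an option. By \<open>det_A\<close> the
  matrix is a unit, which rules out \<open>None\<close> and makes the value a two-sided
  inverse.\<close>

lemma R_props: "A * R = 1\<^sub>m d" "R * A = 1\<^sub>m d" and R_carrier [simp]: "R \<in> carrier_mat d d"
proof -
  have "A \<in> Units (ring_mat TYPE(real) d ())"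
    by (rule det_non_zero_imp_unit[OF A_carrier det_A])
  moreover have "mat_inverse A = None \<Longrightarrow> A \<notin> Units (ring_mat TYPE(real) d ())"
    by (rule mat_inverse(1)[OF A_carrier])
  ultimately obtain B where B: "mat_inverse A = Some B" by (cases "mat_inverse A") auto
  show "A * R = 1\<^sub>m d" "R * A = 1\<^sub>m d" "R \<in> carrier_mat d d"
    using mat_inverse(2)[OF A_carrier B] by (auto simp: minv_def B)
qed

lemma Rv_carrier [simp]: "R *\<^sub>v v \<in> carrier_vec d"
  by (rule carrier_vecI) (use carrier_matD(1)[OF R_carrier] in simp)

lemma A_R: "v \<in> carrier_vec d \<Longrightarrow> A *\<^sub>v (R *\<^sub>v v) = v"
  using assoc_mult_mat_vec[OF A_carrier R_carrier, of v] by (simp add: R_props)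

lemma A_sym: "u \<in> carrier_vec d \<Longrightarrow> v \<in> carrier_vec d \<Longrightarrow> u \<bullet> (A *\<^sub>v v) = (A *\<^sub>v u) \<bullet> v"
  by (simp add: A_mult S_sym scalar_prod_add_distrib[of _ d] add_scalar_prod_distrib[of _ d]
      smult_scalar_prod_distrib[of _ d])

lemma R_sym:
  assumes "u \<in> carrier_vec d" "v \<in> carrier_vec d"
  shows "u \<bullet> (R *\<^sub>v v) = (R *\<^sub>v u) \<bullet> v"
proof -
  have "u \<bullet> (R *\<^sub>v v) = (A *\<^sub>v (R *\<^sub>v u)) \<bullet> (R *\<^sub>v v)" using assms by (simp add: A_R)
  also have "\<dots> = (R *\<^sub>v u) \<bullet> (A *\<^sub>v (R *\<^sub>v v))" by (rule A_sym[symmetric]) auto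
  also have "\<dots> = (R *\<^sub>v u) \<bullet> v" using assms by (simp add: A_R)
  finally show ?thesis .
qed

text \<open>Coercivity \<open>A_lower\<close> at R v, since A (R v) = v. Besides the norm bound 1 /
  lam it yields |R x|^2 / n <= \<alpha> / lam for leave-one-out resolvents.\<close>

lemma R_lower: "v \<in> carrier_vec d \<Longrightarrow> lam * (vnorm (R *\<^sub>v v))\<^sup>2 \<le> v \<bullet> (R *\<^sub>v v)"
  using A_lower[of "R *\<^sub>v v"] comm_scalar_prod[of v d "R *\<^sub>v v"] by (simp add: A_R)

lemma R_nonneg: "v \<in> carrier_vec d \<Longrightarrow> 0 \<le> v \<bullet> (R *\<^sub>v v)"
  using lam by (intro order_trans[OF _ R_lower[of v]] mult_nonneg_nonneg) auto

lemma R_bound: "op_bound d R (1 / lam)"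
  unfolding op_bound_def
proof (intro conjI ballI)
  fix v :: "real vec" assume v: "v \<in> carrier_vec d"
  let ?r = "vnorm (R *\<^sub>v v)"
  have "lam * ?r\<^sup>2 \<le> vnorm v * ?r"
    using R_lower[OF v] scalar_prod_abs_le[OF v, of "R *\<^sub>v v"] by simp
  then have "?r * (lam * ?r - vnorm v) \<le> 0" by (simp add: power2_eq_square algebra_simps)
  then have "?r = 0 \<or> lam * ?r \<le> vnorm v"
    using vnorm_nonneg[of "R *\<^sub>v v"] by (auto simp: mult_le_0_iff)
  then show "?r \<le> 1 / lam * vnorm v"
    using lam by (auto simp: field_simps)
qed (use lam in auto)

text \<open>With z = R w and w = A z the form becomes |S z|^2 + lam (z . S z).\<close>

lemma SR_nonneg:
  assumes w: "w \<in> carrier_vec d"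
  shows "0 \<le> w \<bullet> (S *\<^sub>v (R *\<^sub>v w))"
proof -
  let ?z = "R *\<^sub>v w"
  have "w \<bullet> (S *\<^sub>v ?z) = (S *\<^sub>v ?z) \<bullet> (A *\<^sub>v ?z)" using w comm_scalar_prod[of w d "S *\<^sub>v ?z"] by (simp add: A_R)
  also have "\<dots> = (S *\<^sub>v ?z) \<bullet> (S *\<^sub>v ?z) + lam * (?z \<bullet> (S *\<^sub>v ?z))"
    using comm_scalar_prod[of "S *\<^sub>v ?z" d ?z] by (simp add: scalar_prod_A)
  finally show ?thesis
    using scalar_prod_self_nonneg[of "S *\<^sub>v ?z"] S_nonneg[of ?z] lam by simp
qed

end

text \<open>This is R1 - R2 = R1 (S2 - S1) R2 tested with u and v, with R1 moved onto u; the ridge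
  terms cancel. Later S1 is the full sample matrix, and S2 is either the population matrix or a
  leave-one-out matrix.\<close>

lemma resolvent_identity:
  assumes 1: "ridge d S1 lam" and 2: "ridge d S2 lam"
    and u: "u \<in> carrier_vec d" and v: "v \<in> carrier_vec d"
  defines "R1 \<equiv> minv (S1 + lam \<cdot>\<^sub>m 1\<^sub>m d)" and "R2 \<equiv> minv (S2 + lam \<cdot>\<^sub>m 1\<^sub>m d)"
  shows "u \<bullet> (R1 *\<^sub>v v) - u \<bullet> (R2 *\<^sub>v v)
    = (R1 *\<^sub>v u) \<bullet> (S2 *\<^sub>v (R2 *\<^sub>v v)) - (R1 *\<^sub>v u) \<bullet> (S1 *\<^sub>v (R2 *\<^sub>v v))"
proof -
  interpret r1: ridge d S1 lam by fact
  interpret r2: ridge d S2 lam by fact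
  have "u \<bullet> (R1 *\<^sub>v v) = (R1 *\<^sub>v u) \<bullet> (r2.A *\<^sub>v (R2 *\<^sub>v v))"
    unfolding R1_def R2_def using u v by (simp add: r2.A_R r1.R_sym)
  also have "\<dots> = (R1 *\<^sub>v u) \<bullet> (S2 *\<^sub>v (R2 *\<^sub>v v)) + lam * ((R1 *\<^sub>v u) \<bullet> (R2 *\<^sub>v v))"
    unfolding R1_def R2_def by (simp add: r2.scalar_prod_A)
  finally have e1: "u \<bullet> (R1 *\<^sub>v v) = \<dots>" .
  have "u \<bullet> (R2 *\<^sub>v v) = (r1.A *\<^sub>v (R1 *\<^sub>v u)) \<bullet> (R2 *\<^sub>v v)"
    unfolding R1_def R2_def using u v by (simp add: r1.A_R)
  also have "\<dots> = (R1 *\<^sub>v u) \<bullet> (r1.A *\<^sub>v (R2 *\<^sub>v v))"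
    unfolding R1_def R2_def by (simp add: r1.A_sym)
  also have "\<dots> = (R1 *\<^sub>v u) \<bullet> (S1 *\<^sub>v (R2 *\<^sub>v v)) + lam * ((R1 *\<^sub>v u) \<bullet> (R2 *\<^sub>v v))"
    unfolding R1_def R2_def by (simp add: r1.scalar_prod_A)
  finally show ?thesis using e1 by simp
qed

section \<open>Measurability and square integrability\<close>

lemma borel_measurable_det:
  fixes F :: "'a \<Rightarrow> real mat"
  assumes F: "\<And>\<omega>. F \<omega> \<in> carrier_mat k k"
    and meas: "\<And>i j. i < k \<Longrightarrow> j < k \<Longrightarrow> (\<lambda>\<omega>. F \<omega> $$ (i, j)) \<in> borel_measurable M"
  shows "(\<lambda>\<omega>. det (F \<omega>)) \<in> borel_measurable M"
  unfolding det_def'[OF F]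
  by (intro borel_measurable_sum borel_measurable_times borel_measurable_const borel_measurable_prod meas)
    (auto simp: permutes_in_image)

lemma left_inverse_eq_adj_mat:
  fixes A :: "'a :: field mat"
  assumes A: "A \<in> carrier_mat k k" and X: "X \<in> carrier_mat k k" and XA: "X * A = 1\<^sub>m k"
    and det: "det A \<noteq> 0" and ij: "i < k" "j < k"
  shows "X $$ (i, j) = adj_mat A $$ (i, j) / det A"
proof -
  have "adj_mat A = (X * A) * adj_mat A" using adj_mat(1)[OF A] by (simp add: XA)
  also have "\<dots> = X * (det A \<cdot>\<^sub>m 1\<^sub>m k)"
    using assoc_mult_mat[OF X A adj_mat(1)[OF A]] adj_mat(2)[OF A] by simp
  also have "\<dots> = det A \<cdot>\<^sub>m X"
    using mult_smult_distrib[OF X one_carrier_mat, of "det A"] X by simp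
  finally show ?thesis using X ij det by simp
qed

text \<open>By Cramer's rule each entry of the inverse is a signed minor over the determinant, hence
  a rational function of measurable entries.\<close>

lemma borel_measurable_left_inverse:
  fixes F X :: "'a \<Rightarrow> real mat"
  assumes F: "\<And>\<omega>. F \<omega> \<in> carrier_mat k k" and X: "\<And>\<omega>. X \<omega> \<in> carrier_mat k k"
    and XF: "\<And>\<omega>. X \<omega> * F \<omega> = 1\<^sub>m k" and det: "\<And>\<omega>. det (F \<omega>) \<noteq> 0"
    and meas: "\<And>i j. i < k \<Longrightarrow> j < k \<Longrightarrow> (\<lambda>\<omega>. F \<omega> $$ (i, j)) \<in> borel_measurable M"
    and ij: "i < k" "j < k"
  shows "(\<lambda>\<omega>. X \<omega> $$ (i, j)) \<in> borel_measurable M"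
proof -
  \<comment> \<open>The indices are swapped because the adjugate is the transpose of the cofactor
    matrix.\<close>
  have "(\<lambda>\<omega>. det (mat_delete (F \<omega>) j i)) \<in> borel_measurable M"
  proof (rule borel_measurable_det[OF mat_delete_carrier[OF F]])
    fix a b assume ab: "a < k - 1" "b < k - 1"
    have "mat_delete (F \<omega>) j i $$ (a, b)
        = F \<omega> $$ (if a < j then a else Suc a, if b < i then b else Suc b)" for \<omega>
      using F[of \<omega>] ab by (simp add: mat_delete_def)
    then show "(\<lambda>\<omega>. mat_delete (F \<omega>) j i $$ (a, b)) \<in> borel_measurable M"
      using ab by (auto intro!: meas)
  qed
  moreover have "X \<omega> $$ (i, j) = (- 1) ^ (j + i) * det (mat_delete (F \<omega>) j i) / det (F \<omega>)" for \<omega>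
    using left_inverse_eq_adj_mat[OF F X XF det ij, of \<omega>] F[of \<omega>] ij
    by (simp add: adj_mat_def cofactor_def)
  ultimately show ?thesis
    using borel_measurable_det[OF F meas] by simp
qed

text \<open>Cauchy-Schwarz in terms of upper bounds for the two second moments. The inequality is
  taken for nonnegative integrals and carried over once the product is known to be integrable, which
  follows from |f h| <= f^2 + h^2.\<close>

lemma
  fixes f h :: "'a \<Rightarrow> real"
  assumes [measurable]: "f \<in> borel_measurable M" "h \<in> borel_measurable M"
    and f: "integrable M (\<lambda>x. (f x)\<^sup>2)" "(\<integral>x. (f x)\<^sup>2 \<partial>M) \<le> a\<^sup>2" "0 \<le> a"
    and h: "integrable M (\<lambda>x. (h x)\<^sup>2)" "(\<integral>x. (h x)\<^sup>2 \<partial>M) \<le> b\<^sup>2" "0 \<le> b"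
  shows integrable_mult_L2: "integrable M (\<lambda>x. f x * h x)"
    and integral_abs_mult_le: "(\<integral>x. \<bar>f x * h x\<bar> \<partial>M) \<le> a * b"
proof -
  have int: "integrable M (\<lambda>x. (f x)\<^sup>2 + (h x)\<^sup>2)" using f h by auto
  have le: "\<bar>f x * h x\<bar> \<le> (f x)\<^sup>2 + (h x)\<^sup>2" for x
  proof -
    have "2 * (\<bar>f x\<bar> * \<bar>h x\<bar>) \<le> (f x)\<^sup>2 + (h x)\<^sup>2"
      using zero_le_power2[of "\<bar>f x\<bar> - \<bar>h x\<bar>"] by (simp add: power2_diff)
    moreover have "0 \<le> \<bar>f x\<bar> * \<bar>h x\<bar>" by simp
    ultimately show ?thesis unfolding abs_mult by linarith
  qed
  show fh: "integrable M (\<lambda>x. f x * h x)"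
    by (rule Bochner_Integration.integrable_bound[OF int]) (use le in \<open>auto intro!: AE_I2\<close>)
  have "(\<integral>\<^sup>+x. ennreal \<bar>f x\<bar> * ennreal \<bar>h x\<bar> \<partial>M)\<^sup>2
      \<le> (\<integral>\<^sup>+x. (ennreal \<bar>f x\<bar>)\<^sup>2 \<partial>M) * (\<integral>\<^sup>+x. (ennreal \<bar>h x\<bar>)\<^sup>2 \<partial>M)"
    by (rule Cauchy_Schwarz_nn_integral) auto
  also have "(\<integral>\<^sup>+x. ennreal \<bar>f x\<bar> * ennreal \<bar>h x\<bar> \<partial>M) = ennreal (\<integral>x. \<bar>f x * h x\<bar> \<partial>M)"
    using nn_integral_eq_integral[OF integrable_abs[OF fh]] by (simp add: abs_mult ennreal_mult)
  also have "(\<integral>\<^sup>+x. (ennreal \<bar>f x\<bar>)\<^sup>2 \<partial>M) = ennreal (\<integral>x. (f x)\<^sup>2 \<partial>M)"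
    using nn_integral_eq_integral[OF f(1)] by (simp add: ennreal_power)
  also have "(\<integral>\<^sup>+x. (ennreal \<bar>h x\<bar>)\<^sup>2 \<partial>M) = ennreal (\<integral>x. (h x)\<^sup>2 \<partial>M)"
    using nn_integral_eq_integral[OF h(1)] by (simp add: ennreal_power)
  finally have "(\<integral>x. \<bar>f x * h x\<bar> \<partial>M)\<^sup>2 \<le> (\<integral>x. (f x)\<^sup>2 \<partial>M) * (\<integral>x. (h x)\<^sup>2 \<partial>M)"
    by (simp add: ennreal_power flip: ennreal_mult)
  also have "\<dots> \<le> a\<^sup>2 * b\<^sup>2" using f h by (intro mult_mono) auto
  finally have "(\<integral>x. \<bar>f x * h x\<bar> \<partial>M)\<^sup>2 \<le> (a * b)\<^sup>2" by (simp add: power_mult_distrib)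
  then show "(\<integral>x. \<bar>f x * h x\<bar> \<partial>M) \<le> a * b" using f h by (rule_tac power2_le_imp_le) auto
qed

lemma (in prob_space)
  fixes f :: "'a \<Rightarrow> real"
  assumes [measurable]: "f \<in> borel_measurable M"
    and f: "integrable M (\<lambda>x. (f x)\<^sup>2)" "(\<integral>x. (f x)\<^sup>2 \<partial>M) \<le> a\<^sup>2" "0 \<le> a"
  shows integrable_of_L2: "integrable M f" and integral_abs_le_L2: "(\<integral>x. \<bar>f x\<bar> \<partial>M) \<le> a"
  using integrable_mult_L2[OF _ _ f, of "\<lambda>_. 1" 1] integral_abs_mult_le[OF _ _ f, of "\<lambda>_. 1" 1]
  by (simp_all add: prob_space)

lemma integrable_bounded_by:
  fixes f :: "'a \<Rightarrow> real"
  assumes "f \<in> borel_measurable M" "\<And>x. \<bar>f x\<bar> \<le> K" "finite_measure M"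
  shows "integrable M f"
  using assms by (intro finite_measure.integrable_const_bound[of M f K]) auto

lemma bilinear_eq_sum:
  assumes "W \<in> carrier_mat d d" "u \<in> carrier_vec d" "v \<in> carrier_vec d"
  shows "u \<bullet> (W *\<^sub>v v) = (\<Sum>j<d. \<Sum>k<d. u $ j * (W $$ (j, k) :: real) * v $ k)"
  using assms by (simp add: scalar_prod_def sum_distrib_left atLeast0LessThan mult.assoc)

lemma integrable_dominated:
  fixes f h :: "'a \<Rightarrow> real"
  assumes h: "integrable M h" and f: "f \<in> borel_measurable M" and le: "\<And>x. \<bar>f x\<bar> \<le> h x"
  shows "integrable M f"
proof (rule Bochner_Integration.integrable_bound[OF h f])
  show "AE x in M. norm (f x) \<le> norm (h x)"
    using order_trans[OF le abs_ge_self] by (simp only: real_norm_def AE_I2)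
qed

section \<open>Error terms\<close>

text \<open>Bound for the mean of |g - D|, with C for c, s for sqrt \<nu> and e for 1 / n. The two
  groups come from |T - \<beta>| and |g - \<alpha>|; in each, the s-term is concentration and the
  e-term the cost of removing one observation. The leading factor bounds 1 + c g.\<close>

definition err1 :: "real \<Rightarrow> real \<Rightarrow> real \<Rightarrow> real \<Rightarrow> real \<Rightarrow> real" where
  "err1 \<sigma> lam C s e = (1 + C * (\<sigma> / lam)) * C * ((s * \<sigma> / lam\<^sup>2 + \<sigma>\<^sup>2 / lam\<^sup>2 * e)
      + \<sigma>\<^sup>2 / lam\<^sup>2 * C * (s / lam + \<sigma> / lam * e))"

text \<open>Bound for the mean of (\<alpha> - D)^2: twice the variance of \<alpha> around the
  leave-one-out g, plus twice the mean square of that g minus D.\<close>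

definition err2 :: "real \<Rightarrow> real \<Rightarrow> real \<Rightarrow> real \<Rightarrow> real \<Rightarrow> real" where
  "err2 \<sigma> lam C s e = 2 * (s / lam)\<^sup>2 + 2 * (\<sigma> / lam * (err1 \<sigma> lam C s e + \<sigma> / lam * e))"

text \<open>The first summand is the cost of replacing R by a leave-one-out resolvent, the second is
  Cauchy-Schwarz for the deviation of \<alpha> from D.\<close>

definition err :: "real \<Rightarrow> real \<Rightarrow> real \<Rightarrow> real \<Rightarrow> real \<Rightarrow> real \<Rightarrow> real" where
  "err \<sigma> m lam C s e = C * e * (sqrt m * (1 / lam) * (\<sigma> / lam\<^sup>2))
      + C * (sqrt m * (1 / lam) * (1 / lam)) * sqrt (err2 \<sigma> lam C s e)"

lemma err2_nonneg:
  assumes "0 \<le> \<sigma>" "0 < lam" "0 \<le> C" "0 \<le> s" "0 \<le> e"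
  shows "0 \<le> err2 \<sigma> lam C s e"
  unfolding err2_def err1_def using assms by auto

lemma err_nonneg:
  assumes "0 \<le> \<sigma>" "0 \<le> m" "0 < lam" "0 \<le> C" "0 \<le> s" "0 \<le> e"
  shows "0 \<le> err \<sigma> m lam C s e"
  unfolding err_def using assms err2_nonneg[OF assms(1,3-6)] by auto

text \<open>c changes with n, while the limit is taken for one fixed C; monotonicity bridges the
  two.\<close>

lemma err_mono:
  assumes "0 \<le> \<sigma>" "0 \<le> m" "0 < lam" "0 \<le> C" "C \<le> C'" "0 \<le> s" "0 \<le> e"
  shows "err \<sigma> m lam C s e \<le> err \<sigma> m lam C' s e"
proof -
  have "err1 \<sigma> lam C s e \<le> err1 \<sigma> lam C' s e"
    unfolding err1_def using assms by (intro mult_mono add_mono order_refl) auto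
  then have "err2 \<sigma> lam C s e \<le> err2 \<sigma> lam C' s e"
    unfolding err2_def using assms by (intro mult_left_mono add_mono order_refl) auto
  then show ?thesis
    unfolding err_def using assms err2_nonneg[OF assms(1,3,4,6,7)]
    by (intro mult_mono add_mono order_refl) auto
qed

lemma err_tendsto_0:
  assumes "(s \<longlongrightarrow> 0) F" "(e \<longlongrightarrow> 0) F"
  shows "((\<lambda>k. err \<sigma> m lam C (s k) (e k)) \<longlongrightarrow> 0) F"
proof -
  have "((\<lambda>k. err \<sigma> m lam C (s k) (e k)) \<longlongrightarrow> err \<sigma> m lam C 0 0) F"
    unfolding err_def err2_def err1_def divide_inverse by (intro tendsto_intros assms)
  then show ?thesis by (simp add: err_def err2_def err1_def)
qed

section \<open>The population\<close>

lemma square_integrable_sum: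
  fixes f :: "'i \<Rightarrow> 'a \<Rightarrow> real"
  assumes "finite I" and "\<And>i. i \<in> I \<Longrightarrow> f i \<in> borel_measurable M"
    and "\<And>i. i \<in> I \<Longrightarrow> integrable M (\<lambda>x. (f i x)\<^sup>2)"
  shows "integrable M (\<lambda>x. (\<Sum>i\<in>I. f i x)\<^sup>2)"
  using assms
proof (induction I rule: finite_induct)
  case (insert i I)
  have meas [measurable]: "f i \<in> borel_measurable M" "(\<lambda>x. \<Sum>i\<in>I. f i x) \<in> borel_measurable M"
    using insert by (auto intro!: borel_measurable_sum)
  have int: "integrable M (\<lambda>x. 2 * (f i x)\<^sup>2 + 2 * (\<Sum>i\<in>I. f i x)\<^sup>2)"
    using insert by auto
  show ?case
  proof (rule Bochner_Integration.integrable_bound[OF int])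
    show "(\<lambda>x. (\<Sum>i\<in>insert i I. f i x)\<^sup>2) \<in> borel_measurable M"
      using insert by simp
    have "(f i x + (\<Sum>i\<in>I. f i x))\<^sup>2 \<le> 2 * (f i x)\<^sup>2 + 2 * (\<Sum>i\<in>I. f i x)\<^sup>2" for x
      using zero_le_power2[of "f i x - (\<Sum>i\<in>I. f i x)"] by (simp add: power2_eq_square algebra_simps)
    then show "AE x in M. norm ((\<Sum>i\<in>insert i I. f i x)\<^sup>2)
        \<le> norm (2 * (f i x)\<^sup>2 + 2 * (\<Sum>i\<in>I. f i x)\<^sup>2)"
      using insert by auto
  qed
qed auto

lemma quad_form_eq_sum:
  assumes "B \<in> carrier_mat d d"
  shows "vec d x \<bullet> (B *\<^sub>v vec d x) = (\<Sum>j<d. \<Sum>k<d. x j * (B $$ (j, k) :: real) * x k)"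
  using assms by (simp add: scalar_prod_def sum_distrib_left atLeast0LessThan mult.assoc)

locale population = prob_space P for P :: "(nat \<Rightarrow> real) measure" +
  fixes d :: nat and m \<sigma> :: real and S :: "real mat"
  assumes sets_P: "sets P = sets (vecspace d)"
    and m_nonneg: "0 \<le> m"
    and fourth_unit: "\<And>e. e \<in> carrier_vec d \<Longrightarrow> vnorm e = 1 \<Longrightarrow>
      (\<integral>\<^sup>+x. ennreal ((e \<bullet> vec d x) ^ 4) \<partial>P) \<le> ennreal m"
    and \<sigma>_def: "\<sigma> = 1 + m"
    and S_eq: "S = mat d d (\<lambda>(j, k). \<integral>x. x j * x k \<partial>P)"
begin

lemma measurable_coord [measurable]: "k < d \<Longrightarrow> (\<lambda>x. x k) \<in> borel_measurable P"
  using measurable_component_singleton[of k "{..<d}" "\<lambda>_. borel"]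
  by (simp add: measurable_cong_sets[OF sets_P refl])

lemma measurable_linear [measurable]: "(\<lambda>x. a \<bullet> vec d x) \<in> borel_measurable P"
  by (simp add: scalar_prod_def)

text \<open>\<open>fourth_unit\<close> speaks of unit vectors only, so a and b are normalised, with
  zero vectors set apart. For unit vectors, p^2 q^2 <= (p^4 + q^4) / 2 reduces the mixed moment to
  pure fourth moments.\<close>

lemma
  assumes a: "a \<in> carrier_vec d" and b: "b \<in> carrier_vec d"
  shows integrable_linear_sq: "integrable P (\<lambda>x. (a \<bullet> vec d x)\<^sup>2 * (b \<bullet> vec d x)\<^sup>2)"
    and integral_linear_sq: "(\<integral>x. (a \<bullet> vec d x)\<^sup>2 * (b \<bullet> vec d x)\<^sup>2 \<partial>P) \<le> m * (vnorm a)\<^sup>2 * (vnorm b)\<^sup>2"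
proof -
  have four: "integrable P (\<lambda>x. (e \<bullet> vec d x) ^ 4)" "(\<integral>x. (e \<bullet> vec d x) ^ 4 \<partial>P) \<le> m"
    if "e \<in> carrier_vec d" "vnorm e = 1" for e
  proof -
    show 1: "integrable P (\<lambda>x. (e \<bullet> vec d x) ^ 4)"
      by (rule integrableI_bounded)
        (use fourth_unit[OF that] in \<open>auto simp: order_le_less_trans[OF _ ennreal_less_top]\<close>)
    show "(\<integral>x. (e \<bullet> vec d x) ^ 4 \<partial>P) \<le> m"
      using fourth_unit[OF that] m_nonneg nn_integral_eq_integral[OF 1]
      by (simp add: zero_le_even_power)
  qed
  have "integrable P (\<lambda>x. (a \<bullet> vec d x)\<^sup>2 * (b \<bullet> vec d x)\<^sup>2) \<and>
    (\<integral>x. (a \<bullet> vec d x)\<^sup>2 * (b \<bullet> vec d x)\<^sup>2 \<partial>P) \<le> m * (vnorm a)\<^sup>2 * (vnorm b)\<^sup>2"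
  proof (cases "vnorm a = 0 \<or> vnorm b = 0")
    case True
    then have "(\<lambda>x. (a \<bullet> vec d x)\<^sup>2 * (b \<bullet> vec d x)\<^sup>2) = (\<lambda>x. 0)"
      using vnorm_eq_0_iff[OF a] vnorm_eq_0_iff[OF b] by (intro ext) auto
    then show ?thesis using True by auto
  next
    case False
    obtain e where e: "e \<in> carrier_vec d" "vnorm e = 1" "a = vnorm a \<cdot>\<^sub>v e"
      using vec_normalize[OF a] False by auto
    obtain f where f: "f \<in> carrier_vec d" "vnorm f = 1" "b = vnorm b \<cdot>\<^sub>v f"
      using vec_normalize[OF b] False by auto
    let ?g = "\<lambda>x. (e \<bullet> vec d x)\<^sup>2 * (f \<bullet> vec d x)\<^sup>2"
    let ?h = "\<lambda>x. ((e \<bullet> vec d x) ^ 4 + (f \<bullet> vec d x) ^ 4) / 2"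
    have le: "?g x \<le> ?h x" for x
      using zero_le_power2[of "(e \<bullet> vec d x)\<^sup>2 - (f \<bullet> vec d x)\<^sup>2"]
      by (simp add: power2_diff power4_eq_xxxx power2_eq_square algebra_simps)
    have inth: "integrable P ?h" using four(1)[OF e(1,2)] four(1)[OF f(1,2)] by auto
    have intg: "integrable P ?g"
      by (rule Bochner_Integration.integrable_bound[OF inth]) (use le in \<open>simp_all add: abs_mult\<close>)
    have "(\<integral>x. ?g x \<partial>P) \<le> (\<integral>x. ?h x \<partial>P)" by (rule integral_mono[OF intg inth le])
    also have "\<dots> \<le> m" using four[OF e(1,2)] four[OF f(1,2)] by simp
    finally have "(\<integral>x. ?g x \<partial>P) \<le> m" .
    moreover have "(a \<bullet> vec d x)\<^sup>2 * (b \<bullet> vec d x)\<^sup>2 = (vnorm a)\<^sup>2 * (vnorm b)\<^sup>2 * ?g x" for x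
      by (subst e(3), subst f(3)) (use e(1) f(1) in \<open>simp add: power_mult_distrib\<close>)
    ultimately show ?thesis using intg
      by (auto simp: mult.commute[of m] mult.assoc intro!: mult_left_mono)
  qed
  then show "integrable P (\<lambda>x. (a \<bullet> vec d x)\<^sup>2 * (b \<bullet> vec d x)\<^sup>2)"
    "(\<integral>x. (a \<bullet> vec d x)\<^sup>2 * (b \<bullet> vec d x)\<^sup>2 \<partial>P) \<le> m * (vnorm a)\<^sup>2 * (vnorm b)\<^sup>2" by auto
qed

lemma abs_le_one_plus_square: "\<bar>t\<bar> \<le> 1 + (t::real)\<^sup>2"
proof -
  have "0 \<le> (\<bar>t\<bar> - 1)\<^sup>2" by simp
  then show ?thesis by (simp add: power2_diff)
qed

lemma integrable_linear_prod:
  assumes "a \<in> carrier_vec d" "b \<in> carrier_vec d"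
  shows "integrable P (\<lambda>x. (a \<bullet> vec d x) * (b \<bullet> vec d x))"
proof (rule Bochner_Integration.integrable_bound)
  show "integrable P (\<lambda>x. 1 + (a \<bullet> vec d x)\<^sup>2 * (b \<bullet> vec d x)\<^sup>2)"
    using integrable_linear_sq[OF assms] by auto
  show "AE x in P. norm ((a \<bullet> vec d x) * (b \<bullet> vec d x))
      \<le> norm (1 + (a \<bullet> vec d x)\<^sup>2 * (b \<bullet> vec d x)\<^sup>2)"
    using abs_le_one_plus_square[of "(a \<bullet> vec d x) * (b \<bullet> vec d x)" for x]
    by (auto simp: power_mult_distrib)
qed simp

lemma unit_vec_vec: "k < d \<Longrightarrow> unit_vec d k \<bullet> vec d x = (x k :: real)"
  by simp

lemma integrable_coord_prod: "j < d \<Longrightarrow> k < d \<Longrightarrow> integrable P (\<lambda>x. x j * x k)"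
  using integrable_linear_prod[of "unit_vec d j" "unit_vec d k"] by (simp add: unit_vec_vec)

lemma S_carrier: "S \<in> carrier_mat d d"
  by (simp add: S_eq)

lemma S_bilinear:
  assumes a: "a \<in> carrier_vec d" and b: "b \<in> carrier_vec d"
  shows "(\<integral>x. (a \<bullet> vec d x) * (b \<bullet> vec d x) \<partial>P) = a \<bullet> (S *\<^sub>v b)"
proof -
  have "(\<integral>x. (a \<bullet> vec d x) * (b \<bullet> vec d x) \<partial>P)
      = (\<integral>x. (\<Sum>j<d. \<Sum>k<d. a $ j * b $ k * (x j * x k)) \<partial>P)"
    by (simp add: scalar_prod_def sum_product atLeast0LessThan ac_simps)
  also have "\<dots> = (\<Sum>j<d. \<Sum>k<d. a $ j * b $ k * (\<integral>x. x j * x k \<partial>P))"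
    by (subst Bochner_Integration.integral_sum Bochner_Integration.integral_mult_right
        | auto intro!: Bochner_Integration.integrable_sum sum.cong integrable_coord_prod)+
  also have "\<dots> = a \<bullet> (S *\<^sub>v b)"
    using a b by (simp add: S_eq scalar_prod_def atLeast0LessThan sum_distrib_left ac_simps)
  finally show ?thesis .
qed

lemma S_psd: "psd_mat d S"
  unfolding psd_mat_def
proof (intro conjI ballI S_carrier)
  fix u v :: "real vec" assume u: "u \<in> carrier_vec d" and v: "v \<in> carrier_vec d"
  have "u \<bullet> (S *\<^sub>v v) = v \<bullet> (S *\<^sub>v u)"
    unfolding S_bilinear[OF u v, symmetric] S_bilinear[OF v u, symmetric] by (simp add: mult.commute)
  also have "\<dots> = (S *\<^sub>v u) \<bullet> v" using S_carrier u v by (auto intro!: comm_scalar_prod)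
  finally show "u \<bullet> (S *\<^sub>v v) = (S *\<^sub>v u) \<bullet> v" .
next
  fix v :: "real vec" assume v: "v \<in> carrier_vec d"
  show "0 \<le> v \<bullet> (S *\<^sub>v v)" unfolding S_bilinear[OF v v, symmetric] by simp
qed

lemma \<sigma>_pos: "0 < \<sigma>"
  using m_nonneg by (simp add: \<sigma>_def)

text \<open>For t = (u . x)(v . x) one has |t| <= 1 + t^2, and the mean of t^2 is at most m. This is
  the origin of \<sigma> = 1 + m.\<close>

lemma S_bound: "op_bound d S \<sigma>"
proof (rule op_bound_of_bilinear[OF S_carrier])
  fix u v :: "real vec"
  assume uv: "u \<in> carrier_vec d" "v \<in> carrier_vec d" "vnorm u = 1" "vnorm v = 1"
  have "\<bar>u \<bullet> (S *\<^sub>v v)\<bar> \<le> (\<integral>x. \<bar>(u \<bullet> vec d x) * (v \<bullet> vec d x)\<bar> \<partial>P)"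
    unfolding S_bilinear[OF uv(1,2), symmetric] by (rule integral_abs_bound)
  also have "\<dots> \<le> (\<integral>x. 1 + (u \<bullet> vec d x)\<^sup>2 * (v \<bullet> vec d x)\<^sup>2 \<partial>P)"
  proof (rule integral_mono)
    fix x show "\<bar>(u \<bullet> vec d x) * (v \<bullet> vec d x)\<bar> \<le> 1 + (u \<bullet> vec d x)\<^sup>2 * (v \<bullet> vec d x)\<^sup>2"
      using abs_le_one_plus_square[of "(u \<bullet> vec d x) * (v \<bullet> vec d x)"] by (simp add: power_mult_distrib)
  qed (use integrable_linear_prod[OF uv(1,2)] integrable_linear_sq[OF uv(1,2)] in auto)
  also have "\<dots> \<le> \<sigma>"
    using integrable_linear_sq[OF uv(1,2)] integral_linear_sq[OF uv(1,2)] uv by (simp add: \<sigma>_def prob_space)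
  finally show "\<bar>u \<bullet> (S *\<^sub>v v)\<bar> \<le> \<sigma>" .
qed (use \<sigma>_pos in auto)

text \<open>This is the trace of S B (see \<open>mtrace_eq_tau\<close>), expressed as a mean. Trace
  identities can then be obtained by testing with a random z and integrating, and the centring in
  (A2) has this very form.\<close>

definition tau :: "real mat \<Rightarrow> real" where
  "tau B = (\<integral>x. vec d x \<bullet> (B *\<^sub>v vec d x) \<partial>P)"

lemma measurable_quad [measurable]: "B \<in> carrier_mat d d \<Longrightarrow> (\<lambda>x. vec d x \<bullet> (B *\<^sub>v vec d x)) \<in> borel_measurable P"
  by (simp add: quad_form_eq_sum)

lemma integrable_quad: "B \<in> carrier_mat d d \<Longrightarrow> integrable P (\<lambda>x. vec d x \<bullet> (B *\<^sub>v vec d x))"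
proof -
  assume B: "B \<in> carrier_mat d d"
  have "integrable P (\<lambda>x. \<Sum>j<d. \<Sum>k<d. B $$ (j, k) * (x j * x k))"
    by (intro Bochner_Integration.integrable_sum integrable_mult_right integrable_coord_prod) auto
  then show ?thesis using B by (simp add: quad_form_eq_sum ac_simps)
qed

lemma tau_eq_sum: "B \<in> carrier_mat d d \<Longrightarrow> tau B = (\<Sum>j<d. \<Sum>k<d. B $$ (j, k) * S $$ (j, k))"
proof -
  assume B: "B \<in> carrier_mat d d"
  have "tau B = (\<integral>x. (\<Sum>j<d. \<Sum>k<d. B $$ (j, k) * (x j * x k)) \<partial>P)"
    using B by (simp add: tau_def quad_form_eq_sum ac_simps)
  also have "\<dots> = (\<Sum>j<d. \<Sum>k<d. B $$ (j, k) * (\<integral>x. x j * x k \<partial>P))"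
    by (subst Bochner_Integration.integral_sum Bochner_Integration.integral_mult_right
        | auto intro!: Bochner_Integration.integrable_sum sum.cong integrable_coord_prod)+
  finally show ?thesis by (simp add: S_eq)
qed

lemma mtrace_eq_tau:
  assumes B: "B \<in> carrier_mat d d"
  shows "mtrace (S * B) = tau B"
proof -
  have "mtrace (S * B) = (\<Sum>j<d. \<Sum>k<d. S $$ (j, k) * B $$ (k, j))"
    using S_carrier B by (simp add: mtrace_def scalar_prod_def atLeast0LessThan)
  also have "\<dots> = (\<Sum>k<d. \<Sum>j<d. S $$ (j, k) * B $$ (k, j))" by (rule sum.swap)
  also have "\<dots> = tau B"
    unfolding tau_eq_sum[OF B] by (intro sum.cong refl) (simp add: S_eq mult.commute)
  finally show ?thesis .
qed

lemma integrable_norm_sq: "integrable P (\<lambda>x. (vnorm (vec d x))\<^sup>2)"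
  and integral_norm_sq: "(\<integral>x. (vnorm (vec d x))\<^sup>2 \<partial>P) \<le> real d * \<sigma>"
proof -
  have eq: "(vnorm (vec d x))\<^sup>2 = (\<Sum>j<d. x j * x j)" for x
    unfolding vnorm_sq scalar_prod_self by (simp add: power2_eq_square)
  show "integrable P (\<lambda>x. (vnorm (vec d x))\<^sup>2)"
    unfolding eq by (auto intro!: integrable_coord_prod)
  have "(\<integral>x. (vnorm (vec d x))\<^sup>2 \<partial>P) = (\<Sum>j<d. \<integral>x. x j * x j \<partial>P)"
    unfolding eq by (auto intro!: integrable_coord_prod Bochner_Integration.integral_sum)
  also have "\<dots> \<le> (\<Sum>j<d. \<sigma>)"
  proof (rule sum_mono)
    fix j assume "j \<in> {..<d}"
    then have "(\<integral>x. x j * x j \<partial>P) = unit_vec d j \<bullet> (S *\<^sub>v unit_vec d j)" "j < d"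
      using S_bilinear[of "unit_vec d j" "unit_vec d j"] by (simp_all add: unit_vec_vec)
    then show "(\<integral>x. x j * x j \<partial>P) \<le> \<sigma>"
      using op_bound_bilinear[OF S_bound, of "unit_vec d j" "unit_vec d j"] by simp
  qed
  finally show "(\<integral>x. (vnorm (vec d x))\<^sup>2 \<partial>P) \<le> real d * \<sigma>" by simp
qed

lemma tau_bound: "op_bound d B K \<Longrightarrow> \<bar>tau B\<bar> \<le> K * (real d * \<sigma>)"
proof -
  assume B: "op_bound d B K"
  have "\<bar>tau B\<bar> \<le> (\<integral>x. \<bar>vec d x \<bullet> (B *\<^sub>v vec d x)\<bar> \<partial>P)"
    unfolding tau_def by (rule integral_abs_bound)
  also have "\<dots> \<le> (\<integral>x. K * (vnorm (vec d x))\<^sup>2 \<partial>P)"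
  proof (rule integral_mono)
    fix x show "\<bar>vec d x \<bullet> (B *\<^sub>v vec d x)\<bar> \<le> K * (vnorm (vec d x))\<^sup>2"
      using op_bound_bilinear[OF B, of "vec d x" "vec d x"] by (simp add: power2_eq_square)
  qed (use integrable_quad[OF op_boundD(1)[OF B]] integrable_norm_sq in auto)
  also have "\<dots> \<le> K * (real d * \<sigma>)"
    using integral_norm_sq op_boundD(2)[OF B] integrable_norm_sq by (auto intro!: mult_left_mono)
  finally show ?thesis .
qed

text \<open>A Bochner integral defaults to 0 for a non-integrable function, so the inequality in
  \<open>concentration\<close> carries information only together with this fact, which the fourth
  moments supply.\<close>

lemma integrable_quad_centered_sq:
  assumes B: "B \<in> carrier_mat d d"
  shows "integrable P (\<lambda>x. (vec d x \<bullet> (B *\<^sub>v vec d x) - t)\<^sup>2)"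
proof -
  have *: "integrable P (\<lambda>x. (\<Sum>(j, k)\<in>{..<d} \<times> {..<d}. B $$ (j, k) * (x j * x k))\<^sup>2)"
  proof (rule square_integrable_sum)
    fix i assume "i \<in> {..<d} \<times> {..<d}"
    then obtain j k where i: "i = (j, k)" "j < d" "k < d" by auto
    show "(\<lambda>x. case i of (j, k) \<Rightarrow> B $$ (j, k) * (x j * x k)) \<in> borel_measurable P"
      using i by simp
    show "integrable P (\<lambda>x. (case i of (j, k) \<Rightarrow> B $$ (j, k) * (x j * x k))\<^sup>2)"
      using integrable_linear_sq[of "unit_vec d j" "unit_vec d k"] i
      by (simp add: unit_vec_vec power_mult_distrib)
  qed auto
  have eq: "vec d x \<bullet> (B *\<^sub>v vec d x) = (\<Sum>(j, k)\<in>{..<d} \<times> {..<d}. B $$ (j, k) * (x j * x k))" for x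
    using B by (simp add: quad_form_eq_sum sum.cartesian_product ac_simps)
  have "integrable P (\<lambda>x. (vec d x \<bullet> (B *\<^sub>v vec d x))\<^sup>2)" using * unfolding eq .
  then show ?thesis using integrable_quad[OF B] by (simp add: power2_diff)
qed

end

locale concentrated_population = population +
  fixes \<nu> :: real
  assumes d_pos: "0 < d"
    and concentration: "\<And>B. B \<in> carrier_mat d d \<Longrightarrow> spec_norm B = 1 \<Longrightarrow>
      (\<integral>x. (vec d x \<bullet> (B *\<^sub>v vec d x) / real d - tau B / real d)\<^sup>2 \<partial>P) \<le> \<nu>"
    and \<nu>_nonneg: "0 \<le> \<nu>"
begin

text \<open>\<open>concentration\<close> covers spectral norm 1 only: divide B by its norm and scale
  back. A matrix of norm zero has vanishing quadratic form and is treated apart.\<close>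

lemma quad_variance:
  assumes B: "op_bound d B K"
  shows "(\<integral>x. (vec d x \<bullet> (B *\<^sub>v vec d x) - tau B)\<^sup>2 \<partial>P) \<le> \<nu> * (real d)\<^sup>2 * K\<^sup>2"
proof (cases "spec_norm B = 0")
  case True
  then have "vec d x \<bullet> (B *\<^sub>v vec d x) = 0" for x
    using op_bound_bilinear[OF op_bound_spec_norm[OF B d_pos], of "vec d x" "vec d x"] by simp
  then show ?thesis using \<nu>_nonneg by (simp add: tau_def)
next
  case False
  define s where "s = spec_norm B"
  have s: "0 < s" "s \<le> K" using False spec_norm_props[OF B d_pos] by (auto simp: s_def)
  define C where "C = (1 / s) \<cdot>\<^sub>m B"
  have Bc: "B \<in> carrier_mat d d" by (rule op_boundD[OF B])
  have C: "C \<in> carrier_mat d d" using Bc by (simp add: C_def)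
  have sC: "spec_norm C = 1"
    unfolding C_def using spec_norm_smult[OF B d_pos, of "1 / s"] s by (simp add: s_def)
  have quad: "vec d x \<bullet> (B *\<^sub>v vec d x) = s * (vec d x \<bullet> (C *\<^sub>v vec d x))" for x
    using s Bc by (simp add: C_def smult_mat_mult_vec[of _ d d])
  then have tauB: "tau B = s * tau C" by (simp add: tau_def)
  have "(vec d x \<bullet> (B *\<^sub>v vec d x) - tau B)\<^sup>2
      = s\<^sup>2 * (real d)\<^sup>2 * (vec d x \<bullet> (C *\<^sub>v vec d x) / real d - tau C / real d)\<^sup>2" for x
    unfolding quad tauB using d_pos
    by (simp add: diff_divide_distrib[symmetric] power_divide right_diff_distrib[symmetric] power_mult_distrib)
  then have "(\<integral>x. (vec d x \<bullet> (B *\<^sub>v vec d x) - tau B)\<^sup>2 \<partial>P)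
      = s\<^sup>2 * (real d)\<^sup>2 * (\<integral>x. (vec d x \<bullet> (C *\<^sub>v vec d x) / real d - tau C / real d)\<^sup>2 \<partial>P)"
    by simp
  also have "\<dots> \<le> K\<^sup>2 * (real d)\<^sup>2 * \<nu>"
    using s by (intro mult_mono concentration[OF C sC]) (auto intro!: power_mono)
  finally show ?thesis by (simp add: ac_simps)
qed

end

section \<open>Leave-one-out algebra for a fixed sample\<close>

text \<open>\<open>d_le_n\<close> holds for all large n because d / n tends to y < 1;
  \<open>eff_dim_lt\<close> is the hypothesis on the effective dimension, read through
  \<open>tau\<close>.\<close>

locale sample_resolvent = concentrated_population +
  fixes n :: nat and lam :: real
  assumes lam: "0 < lam" and d_le_n: "d \<le> n"
    and eff_dim_lt: "tau (minv (S + lam \<cdot>\<^sub>m 1\<^sub>m d)) < real n"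
begin

sublocale B: ridge d S lam
  by unfold_locales (auto simp: S_psd lam)

abbreviation "B \<equiv> minv (S + lam \<cdot>\<^sub>m 1\<^sub>m d)"

definition "D = tau B / real n"

definition "c = 1 / (1 - D)"

text \<open>The divisor stays n for every index set J, so that full and leave-one-out matrices
  differ by exactly one rank-one term.\<close>

definition G :: "nat set \<Rightarrow> (nat \<Rightarrow> nat \<Rightarrow> real) \<Rightarrow> real mat" where
  "G J xs = mat d d (\<lambda>(j, k). c / real n * (\<Sum>i\<in>J. xs i j * xs i k))"

definition R :: "nat set \<Rightarrow> (nat \<Rightarrow> nat \<Rightarrow> real) \<Rightarrow> real mat" where
  "R J xs = minv (G J xs + lam \<cdot>\<^sub>m 1\<^sub>m d)"

abbreviation pt :: "(nat \<Rightarrow> nat \<Rightarrow> real) \<Rightarrow> nat \<Rightarrow> real vec" where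
  "pt xs i \<equiv> vec d (xs i)"

abbreviation others :: "nat \<Rightarrow> nat set" where
  "others i \<equiv> {..<n} - {i}"

lemma n_pos: "0 < n"
  using d_pos d_le_n by simp

lemma d_over_n: "real d / real n \<le> 1"
  using d_le_n n_pos by simp

lemma D_nonneg: "0 \<le> D"
  by (simp add: D_def tau_def B.R_nonneg)

lemma D_lt_1: "D < 1"
  using eff_dim_lt n_pos by (simp add: D_def)

lemma c_ge_1: "1 \<le> c"
  using D_nonneg D_lt_1 by (simp add: c_def)

lemma c_D: "c * D = c - 1"
  using D_lt_1 by (simp add: c_def field_simps)

lemma G_carrier [simp]: "G J xs \<in> carrier_mat d d"
  by (simp add: G_def)

lemma G_bilinear:
  assumes "u \<in> carrier_vec d" "v \<in> carrier_vec d"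
  shows "u \<bullet> (G J xs *\<^sub>v v) = c / real n * (\<Sum>i\<in>J. (u \<bullet> pt xs i) * (pt xs i \<bullet> v))"
proof -
  have "u \<bullet> (G J xs *\<^sub>v v)
      = (\<Sum>j<d. \<Sum>k<d. \<Sum>i\<in>J. c / real n * (u $ j * xs i j * (xs i k * v $ k)))"
    using assms by (simp add: G_def scalar_prod_def atLeast0LessThan sum_distrib_left sum_distrib_right ac_simps)
  also have "\<dots> = (\<Sum>i\<in>J. \<Sum>j<d. \<Sum>k<d. c / real n * (u $ j * xs i j * (xs i k * v $ k)))"
    by (subst sum.swap[of _ J], subst sum.swap[of _ J]) (rule refl)
  also have "\<dots> = c / real n * (\<Sum>i\<in>J. (u \<bullet> pt xs i) * (pt xs i \<bullet> v))"
    using assms by (simp add: scalar_prod_def atLeast0LessThan sum_product)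
      (simp add: sum_distrib_left sum_divide_distrib)
  finally show ?thesis .
qed

lemma pt_scalar_commute: "u \<in> carrier_vec d \<Longrightarrow> pt xs i \<bullet> u = u \<bullet> pt xs i"
  by (rule comm_scalar_prod[of _ d]) auto

lemma ridge_G: "ridge d (G J xs) lam"
proof
  show "psd_mat d (G J xs)"
    unfolding psd_mat_def
  proof (intro conjI ballI)
    fix u v :: "real vec" assume uv: "u \<in> carrier_vec d" "v \<in> carrier_vec d"
    have "u \<bullet> (G J xs *\<^sub>v v) = v \<bullet> (G J xs *\<^sub>v u)"
      using uv by (simp add: G_bilinear pt_scalar_commute ac_simps)
    also have "\<dots> = (G J xs *\<^sub>v u) \<bullet> v"
      using uv mult_mat_vec_carrier[OF G_carrier uv(1)] by (intro comm_scalar_prod[of _ d]) auto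
    finally show "u \<bullet> (G J xs *\<^sub>v v) = (G J xs *\<^sub>v u) \<bullet> v" .
  next
    fix v :: "real vec" assume v: "v \<in> carrier_vec d"
    show "0 \<le> v \<bullet> (G J xs *\<^sub>v v)"
      using v c_ge_1 by (simp add: G_bilinear pt_scalar_commute sum_nonneg)
  qed simp
qed (rule lam)

lemmas R_facts = ridge.R_carrier[OF ridge_G, folded R_def] ridge.Rv_carrier[OF ridge_G, folded R_def]
lemmas R_sym = ridge.R_sym[OF ridge_G, folded R_def]
lemmas R_bound = ridge.R_bound[OF ridge_G, folded R_def]
lemmas R_lower = ridge.R_lower[OF ridge_G, folded R_def]
lemmas R_nonneg = ridge.R_nonneg[OF ridge_G, folded R_def]
declare R_facts [simp]

definition \<alpha> :: "(nat \<Rightarrow> nat \<Rightarrow> real) \<Rightarrow> nat \<Rightarrow> real" where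
  "\<alpha> xs i = pt xs i \<bullet> (R (others i) xs *\<^sub>v pt xs i) / real n"

text \<open>The companion of \<alpha> that arises when the expansion is traced against S; its
  conditional mean given the other observations is the leave-one-out \<open>T\<close>.\<close>

definition \<beta> :: "(nat \<Rightarrow> nat \<Rightarrow> real) \<Rightarrow> nat \<Rightarrow> real" where
  "\<beta> xs i = pt xs i \<bullet> ((B * S * R (others i) xs) *\<^sub>v pt xs i) / real n"

definition g :: "nat set \<Rightarrow> (nat \<Rightarrow> nat \<Rightarrow> real) \<Rightarrow> real" where
  "g J xs = tau (R J xs) / real n"

definition T :: "nat set \<Rightarrow> (nat \<Rightarrow> nat \<Rightarrow> real) \<Rightarrow> real" where
  "T J xs = tau (B * S * R J xs) / real n"

lemma BS_carrier [simp]: "B * S \<in> carrier_mat d d" "B * S * R J xs \<in> carrier_mat d d"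
  using B.R_carrier B.S_carrier R_facts by (metis mult_carrier_mat)+

lemma BSR_mult: "v \<in> carrier_vec d \<Longrightarrow> (B * S * R J xs) *\<^sub>v v = B *\<^sub>v (S *\<^sub>v (R J xs *\<^sub>v v))"
  by (simp add: assoc_mult_mat_vec[of _ d d _ d])

lemma BS_bound: "op_bound d (B * S) (\<sigma> / lam)"
  using op_bound_mult[OF B.R_bound S_bound] by simp

lemma BSR_bound: "op_bound d (B * S * R J xs) (\<sigma> / lam\<^sup>2)"
  using op_bound_mult[OF BS_bound R_bound] by (simp add: power2_eq_square)

lemma \<alpha>_nonneg: "0 \<le> \<alpha> xs i"
  by (simp add: \<alpha>_def R_nonneg)

lemma one_plus_c\<alpha>_pos: "1 \<le> 1 + c * \<alpha> xs i"
  using \<alpha>_nonneg c_ge_1 by simp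

lemma g_nonneg: "0 \<le> g J xs"
  by (simp add: g_def tau_def R_nonneg)

lemma tau_div_bound: "op_bound d W K \<Longrightarrow> \<bar>tau W / real n\<bar> \<le> K * \<sigma>"
proof -
  assume W: "op_bound d W K"
  have "\<bar>tau W / real n\<bar> \<le> K * \<sigma> * (real d / real n)"
    using tau_bound[OF W] n_pos by (simp add: field_simps)
  also have "\<dots> \<le> K * \<sigma> * 1"
    using d_over_n op_boundD(2)[OF W] \<sigma>_pos by (intro mult_left_mono) auto
  finally show ?thesis by simp
qed

lemma g_le: "g J xs \<le> \<sigma> / lam"
  using order_trans[OF abs_ge_self tau_div_bound[OF R_bound[of J xs]]] by (simp add: g_def)

lemma D_le: "D \<le> \<sigma> / lam"
  using order_trans[OF abs_ge_self tau_div_bound[OF B.R_bound]] by (simp add: D_def)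

lemma T_abs_le: "\<bar>T J xs\<bar> \<le> \<sigma>\<^sup>2 / lam\<^sup>2"
  using tau_div_bound[OF BSR_bound[of J xs]] by (simp add: T_def power2_eq_square)

lemma unit_vec_scalar: "w \<in> carrier_vec d \<Longrightarrow> j < d \<Longrightarrow> unit_vec d j \<bullet> w = (w $ j :: real)"
  by simp

section \<open>Removing one observation\<close>

text \<open>In the resolvent identity the two sums share every index except i, so only the i-th
  summand survives.\<close>

lemma R_others_bilinear:
  assumes i: "i < n" and u: "u \<in> carrier_vec d" and v: "v \<in> carrier_vec d"
  shows "u \<bullet> (R (others i) xs *\<^sub>v v) = u \<bullet> (R {..<n} xs *\<^sub>v v)
    + c / real n * (pt xs i \<bullet> (R (others i) xs *\<^sub>v v)) * (u \<bullet> (R {..<n} xs *\<^sub>v pt xs i))"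
proof -
  let ?q = "\<lambda>k. ((R {..<n} xs *\<^sub>v u) \<bullet> pt xs k) * (pt xs k \<bullet> (R (others i) xs *\<^sub>v v))"
  have "sum ?q {..<n} = ?q i + sum ?q (others i)"
    using i by (simp add: sum.remove)
  moreover have "u \<bullet> (R {..<n} xs *\<^sub>v pt xs i) = (R {..<n} xs *\<^sub>v u) \<bullet> pt xs i"
    using u by (simp add: R_sym)
  ultimately show ?thesis
    using resolvent_identity[OF ridge_G[of "{..<n}" xs] ridge_G[of "others i" xs] u v, folded R_def]
    by (simp add: G_bilinear algebra_simps)
qed

lemma R_others_mult:
  assumes i: "i < n" and v: "v \<in> carrier_vec d"
  shows "R (others i) xs *\<^sub>v v = R {..<n} xs *\<^sub>v v
    + (c / real n * (pt xs i \<bullet> (R (others i) xs *\<^sub>v v))) \<cdot>\<^sub>v (R {..<n} xs *\<^sub>v pt xs i)"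
proof (rule eq_vecI)
  note dims = carrier_vecD[OF R_facts(2)]
  fix j assume "j < dim_vec (R {..<n} xs *\<^sub>v v
    + (c / real n * (pt xs i \<bullet> (R (others i) xs *\<^sub>v v))) \<cdot>\<^sub>v (R {..<n} xs *\<^sub>v pt xs i))"
  then have j: "j < d"
    by (simp only: index_add_vec index_smult_vec dims)
  show "(R (others i) xs *\<^sub>v v) $ j = (R {..<n} xs *\<^sub>v v
    + (c / real n * (pt xs i \<bullet> (R (others i) xs *\<^sub>v v))) \<cdot>\<^sub>v (R {..<n} xs *\<^sub>v pt xs i)) $ j"
    using R_others_bilinear[OF i unit_vec_carrier[of d j] v, of xs] j
    by (simp only: unit_vec_scalar[OF R_facts(2)] index_add_vec index_smult_vec dims)
qed (simp only: index_add_vec index_smult_vec carrier_vecD[OF R_facts(2)])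

text \<open>For v = x_i the rank-one correction is itself a multiple of R x_i, and the two terms
  merge.\<close>

lemma R_others_pt:
  assumes i: "i < n"
  shows "R (others i) xs *\<^sub>v pt xs i = (1 + c * \<alpha> xs i) \<cdot>\<^sub>v (R {..<n} xs *\<^sub>v pt xs i)"
  using R_others_mult[OF i, of "pt xs i" xs] n_pos
  by (simp add: \<alpha>_def add_smult_distrib_vec)

lemma R_pt:
  assumes i: "i < n"
  shows "R {..<n} xs *\<^sub>v pt xs i = (1 / (1 + c * \<alpha> xs i)) \<cdot>\<^sub>v (R (others i) xs *\<^sub>v pt xs i)"
  unfolding R_others_pt[OF i] using one_plus_c\<alpha>_pos[of xs i] by (simp add: smult_smult_assoc)

text \<open>With w = R_i x_i the rank-one correction has size at most \<sigma> K (c / (1 + c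
  \<alpha>)) |w|^2 / n. Since |w|^2 / n <= \<alpha> / lam by \<open>R_lower\<close>, the remaining
  factor c \<alpha> / (1 + c \<alpha>) is at most 1, and both c and n disappear from the
  bound.\<close>

lemma tau_perturb:
  assumes i: "i < n" and W: "op_bound d W K"
  shows "\<bar>tau (W * R (others i) xs) - tau (W * R {..<n} xs)\<bar> \<le> K * \<sigma> / lam"
proof -
  note Wc [simp] = op_boundD(1)[OF W]
  let ?Ri = "R (others i) xs" and ?R = "R {..<n} xs" and ?x = "pt xs i"
  define w where "w = ?Ri *\<^sub>v ?x"
  have w [simp]: "w \<in> carrier_vec d" by (simp add: w_def)
  have WRc: "W * R J xs \<in> carrier_mat d d" for J using Wc R_facts(1) by (rule mult_carrier_mat)
  have Wv [simp]: "W *\<^sub>v v \<in> carrier_vec d" if "v \<in> carrier_vec d" for v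
    using Wc that by (rule mult_mat_vec_carrier)
  \<comment> \<open>The difference of the two quadratic forms is a product of two linear forms in z,
    whose mean \<open>S_bilinear\<close> evaluates.\<close>
  have eq: "vec d z \<bullet> ((W * ?Ri) *\<^sub>v vec d z) - vec d z \<bullet> ((W * ?R) *\<^sub>v vec d z)
     = c / real n * ((w \<bullet> vec d z) * ((W *\<^sub>v (?R *\<^sub>v ?x)) \<bullet> vec d z))" for z
  proof -
    have "(W * ?Ri) *\<^sub>v vec d z = W *\<^sub>v (?Ri *\<^sub>v vec d z)"
      by (simp add: assoc_mult_mat_vec[of _ d d _ d])
    also have "\<dots> = W *\<^sub>v (?R *\<^sub>v vec d z) + (c / real n * (?x \<bullet> (?Ri *\<^sub>v vec d z))) \<cdot>\<^sub>v (W *\<^sub>v (?R *\<^sub>v ?x))"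
      by (subst R_others_mult[OF i]) (simp_all add: mult_add_distrib_mat_vec[of _ d d] mult_mat_vec[of _ d d])
    also have "W *\<^sub>v (?R *\<^sub>v vec d z) = (W * ?R) *\<^sub>v vec d z"
      by (simp add: assoc_mult_mat_vec[of _ d d _ d])
    also have "?x \<bullet> (?Ri *\<^sub>v vec d z) = w \<bullet> vec d z"
      by (simp add: R_sym w_def)
    finally show ?thesis
      using mult_mat_vec_carrier[OF WRc[of "{..<n}"], of "vec d z"]
        comm_scalar_prod[of "vec d z" d "W *\<^sub>v (?R *\<^sub>v ?x)"]
      by (simp add: scalar_prod_add_distrib[of _ d])
  qed
  have "tau (W * ?Ri) - tau (W * ?R) = c / real n * (w \<bullet> (S *\<^sub>v (W *\<^sub>v (?R *\<^sub>v ?x))))"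
    unfolding tau_def Bochner_Integration.integral_diff[OF integrable_quad[OF WRc] integrable_quad[OF WRc], symmetric] eq
    by (simp add: S_bilinear)
  then have "\<bar>tau (W * ?Ri) - tau (W * ?R)\<bar> \<le> c / real n * (\<sigma> * vnorm w * vnorm (W *\<^sub>v (?R *\<^sub>v ?x)))"
    using op_bound_bilinear[OF S_bound w, of "W *\<^sub>v (?R *\<^sub>v ?x)"] c_ge_1
    by (simp add: abs_mult mult_left_mono divide_right_mono)
  also have "\<dots> \<le> c / real n * (\<sigma> * vnorm w * (K * (vnorm w / (1 + c * \<alpha> xs i))))"
  proof -
    have "vnorm (?R *\<^sub>v ?x) = vnorm w / (1 + c * \<alpha> xs i)"
      using one_plus_c\<alpha>_pos[of xs i] by (simp add: R_pt[OF i] w_def)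
    then show ?thesis
      using op_boundD(3)[OF W, of "?R *\<^sub>v ?x"] c_ge_1 \<sigma>_pos by (intro mult_left_mono) auto
  qed
  also have "\<dots> = \<sigma> * K * (c / (1 + c * \<alpha> xs i)) * ((vnorm w)\<^sup>2 / real n)"
    by (simp add: power2_eq_square ac_simps)
  also have "\<dots> \<le> \<sigma> * K * (c / (1 + c * \<alpha> xs i)) * (\<alpha> xs i / lam)"
  proof -
    have "(vnorm w)\<^sup>2 / real n \<le> \<alpha> xs i / lam"
      using R_lower[of ?x "others i" xs] lam n_pos by (simp add: w_def \<alpha>_def field_simps)
    then show ?thesis
      using \<sigma>_pos op_boundD(2)[OF W] c_ge_1 one_plus_c\<alpha>_pos[of xs i] by (intro mult_left_mono) auto
  qed
  also have "\<dots> = \<sigma> * K / lam * (c * \<alpha> xs i / (1 + c * \<alpha> xs i))" by (simp add: ac_simps)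
  also have "\<dots> \<le> \<sigma> * K / lam * 1"
    using \<sigma>_pos op_boundD(2)[OF W] lam one_plus_c\<alpha>_pos[of xs i] by (intro mult_left_mono) auto
  finally show ?thesis by (simp add: ac_simps)
qed

lemma op_bound_one: "op_bound d (1\<^sub>m d) 1"
  by (simp add: op_bound_def)

lemma g_perturb: "i < n \<Longrightarrow> \<bar>g (others i) xs - g {..<n} xs\<bar> \<le> \<sigma> / lam / real n"
  using divide_right_mono[OF tau_perturb[OF _ op_bound_one, of i xs], of "real n"]
    left_mult_one_mat[OF R_facts(1)]
  by (simp add: g_def diff_divide_distrib[symmetric])

lemma T_perturb: "i < n \<Longrightarrow> \<bar>T (others i) xs - T {..<n} xs\<bar> \<le> \<sigma>\<^sup>2 / lam\<^sup>2 / real n"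
  using divide_right_mono[OF tau_perturb[OF _ BS_bound, of i xs], of "real n"]
  by (simp add: T_def diff_divide_distrib[symmetric] power2_eq_square)

section \<open>The traced resolvent equation\<close>

text \<open>Puts T into the shape of the population term of \<open>resolvent_identity\<close> tested
  with u = v = z.\<close>

lemma T_eq_integral: "real n * T J xs = (\<integral>z. (R J xs *\<^sub>v vec d z) \<bullet> (S *\<^sub>v (B *\<^sub>v vec d z)) \<partial>P)"
proof -
  have "vec d z \<bullet> ((B * S * R J xs) *\<^sub>v vec d z) = (R J xs *\<^sub>v vec d z) \<bullet> (S *\<^sub>v (B *\<^sub>v vec d z))" for z
  proof -
    have "vec d z \<bullet> (B *\<^sub>v (S *\<^sub>v (R J xs *\<^sub>v vec d z))) = (B *\<^sub>v vec d z) \<bullet> (S *\<^sub>v (R J xs *\<^sub>v vec d z))"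
      by (simp add: B.R_sym)
    also have "\<dots> = (S *\<^sub>v (B *\<^sub>v vec d z)) \<bullet> (R J xs *\<^sub>v vec d z)"
      by (simp add: B.S_sym)
    also have "\<dots> = (R J xs *\<^sub>v vec d z) \<bullet> (S *\<^sub>v (B *\<^sub>v vec d z))"
      by (rule comm_scalar_prod[of _ d]) auto
    finally show ?thesis by (simp add: BSR_mult)
  qed
  then show ?thesis using n_pos by (simp add: T_def tau_def)
qed

text \<open>The resolvent identity, tested with u = v = z and averaged over a fresh draw z from P.
  In the i-th sample term the average turns z z^T into S, and \<open>R_pt\<close> then produces the
  leave-one-out quotient.\<close>

lemma g_minus_D:
  "g {..<n} xs - D = T {..<n} xs - c / real n * (\<Sum>i<n. \<beta> xs i / (1 + c * \<alpha> xs i))"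
proof -
  let ?R = "R {..<n} xs"
  let ?h = "\<lambda>i z. ((?R *\<^sub>v pt xs i) \<bullet> vec d z) * ((B *\<^sub>v pt xs i) \<bullet> vec d z)"
  have "(?R *\<^sub>v vec d z) \<bullet> (S *\<^sub>v (B *\<^sub>v vec d z))
      = (vec d z \<bullet> (?R *\<^sub>v vec d z) - vec d z \<bullet> (B *\<^sub>v vec d z)) + c / real n * (\<Sum>i<n. ?h i z)" for z
  proof -
    have "?h i z = ((?R *\<^sub>v vec d z) \<bullet> pt xs i) * (pt xs i \<bullet> (B *\<^sub>v vec d z))" for i
    proof -
      have "(?R *\<^sub>v pt xs i) \<bullet> vec d z = (?R *\<^sub>v vec d z) \<bullet> pt xs i"
        using R_sym[of "pt xs i" "vec d z" "{..<n}" xs] by (simp add: pt_scalar_commute)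
      then show ?thesis using B.R_sym[of "pt xs i" "vec d z"] by simp
    qed
    then show ?thesis
      using resolvent_identity[OF ridge_G[of "{..<n}" xs] B.ridge_axioms, of "vec d z" "vec d z", folded R_def]
      by (simp add: G_bilinear)
  qed
  then have "real n * T {..<n} xs = (tau ?R - tau B) + c / real n * (\<Sum>i<n. \<integral>z. ?h i z \<partial>P)"
    unfolding T_eq_integral tau_def
    by (simp add: integrable_quad integrable_linear_prod)
  also have "(\<integral>z. ?h i z \<partial>P) = real n * (\<beta> xs i / (1 + c * \<alpha> xs i))" if "i < n" for i
  proof -
    have "(\<integral>z. ?h i z \<partial>P) = (?R *\<^sub>v pt xs i) \<bullet> (S *\<^sub>v (B *\<^sub>v pt xs i))"
      by (simp add: S_bilinear)
    also have "\<dots> = (S *\<^sub>v (?R *\<^sub>v pt xs i)) \<bullet> (B *\<^sub>v pt xs i)" by (simp add: B.S_sym)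
    also have "\<dots> = (B *\<^sub>v pt xs i) \<bullet> (S *\<^sub>v (?R *\<^sub>v pt xs i))" by (rule comm_scalar_prod[of _ d]) auto
    also have "\<dots> = pt xs i \<bullet> (B *\<^sub>v (S *\<^sub>v (?R *\<^sub>v pt xs i)))" by (simp add: B.R_sym)
    also have "\<dots> = pt xs i \<bullet> (B *\<^sub>v (S *\<^sub>v (R (others i) xs *\<^sub>v pt xs i))) / (1 + c * \<alpha> xs i)"
      using that by (simp add: R_pt mult_mat_vec[of _ d d])
    finally show ?thesis using n_pos by (simp add: \<beta>_def BSR_mult)
  qed
  then have "(\<Sum>i<n. \<integral>z. ?h i z \<partial>P) = real n * (\<Sum>i<n. \<beta> xs i / (1 + c * \<alpha> xs i))"
    by (simp add: sum_distrib_left)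
  finally have "real n * T {..<n} xs = real n * (g {..<n} xs - D + c / real n * (\<Sum>i<n. \<beta> xs i / (1 + c * \<alpha> xs i)))"
    using n_pos by (simp add: g_def D_def algebra_simps)
  then show ?thesis using n_pos by simp
qed

text \<open>g - T is a multiple of the trace of a product of positive semidefinite matrices. Expanding
  R = R (G + lam I) R writes it as a sum of nonnegative quadratic forms without square roots.\<close>

lemma T_le_g: "T {..<n} xs \<le> g {..<n} xs"
proof -
  let ?R = "R {..<n} xs"
  let ?h = "\<lambda>y z. ((?R *\<^sub>v y) \<bullet> vec d z) * ((B *\<^sub>v (?R *\<^sub>v y)) \<bullet> vec d z)"
  interpret G: ridge d "G {..<n} xs" lam by (rule ridge_G)
  have h_nonneg: "0 \<le> (\<integral>z. ?h y z \<partial>P)" for y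
    by (simp add: S_bilinear B.SR_nonneg)
  have h_int: "integrable P (?h y)" for y
    by (simp add: integrable_linear_prod)
  \<comment> \<open>S B = 1 - lam B turns R S B into R - lam R B. In the expansion of R B, the
    \<open>pt\<close> terms come from G and the \<open>unit_vec\<close> terms from writing the
    identity as the sum of e_l e_l^T.\<close>
  have "(?R *\<^sub>v vec d z) \<bullet> (S *\<^sub>v (B *\<^sub>v vec d z)) = vec d z \<bullet> (?R *\<^sub>v vec d z)
      - lam * (c / real n * (\<Sum>i<n. ?h (pt xs i) z) + lam * (\<Sum>l<d. ?h (unit_vec d l) z))" for z
  proof -
    let ?z = "vec d z"
    have h_eq: "?h y z = ((?R *\<^sub>v (B *\<^sub>v ?z)) \<bullet> y) * (y \<bullet> (?R *\<^sub>v ?z))" if y: "y \<in> carrier_vec d" for y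
    proof -
      have "(B *\<^sub>v (?R *\<^sub>v y)) \<bullet> ?z = (?R *\<^sub>v y) \<bullet> (B *\<^sub>v ?z)" by (simp add: B.R_sym)
      also have "\<dots> = y \<bullet> (?R *\<^sub>v (B *\<^sub>v ?z))" using y by (simp add: R_sym)
      also have "\<dots> = (?R *\<^sub>v (B *\<^sub>v ?z)) \<bullet> y" using y by (intro comm_scalar_prod[of _ d]) auto
      finally show ?thesis using y by (simp add: R_sym)
    qed
    have "(B *\<^sub>v ?z) \<bullet> (?R *\<^sub>v ?z) = (?R *\<^sub>v (B *\<^sub>v ?z)) \<bullet> (G.A *\<^sub>v (?R *\<^sub>v ?z))"
      by (simp add: R_def G.A_R G.R_sym)
    also have "\<dots> = c / real n * (\<Sum>i<n. ?h (pt xs i) z)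
        + lam * ((?R *\<^sub>v (B *\<^sub>v ?z)) \<bullet> (?R *\<^sub>v ?z))"
      by (simp add: G.scalar_prod_A G_bilinear h_eq)
    also have "(?R *\<^sub>v (B *\<^sub>v ?z)) \<bullet> (?R *\<^sub>v ?z)
        = (\<Sum>l<d. (?R *\<^sub>v (B *\<^sub>v ?z)) $ l * (?R *\<^sub>v ?z) $ l)"
      using carrier_vecD[OF R_facts(2)] by (simp only: scalar_prod_def atLeast0LessThan)
    also have "\<dots> = (\<Sum>l<d. ?h (unit_vec d l) z)"
    proof (rule sum.cong[OF refl])
      fix l assume "l \<in> {..<d}"
      then have l: "l < d" by simp
      have "(?R *\<^sub>v (B *\<^sub>v ?z)) \<bullet> unit_vec d l = (?R *\<^sub>v (B *\<^sub>v ?z)) $ l"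
        using l by (subst comm_scalar_prod[of _ d]) (auto simp only: unit_vec_scalar R_facts unit_vec_carrier)
      then show "(?R *\<^sub>v (B *\<^sub>v ?z)) $ l * (?R *\<^sub>v ?z) $ l = ?h (unit_vec d l) z"
        using l unit_vec_scalar[OF R_facts(2), of l "{..<n}" xs ?z] by (simp only: h_eq[OF unit_vec_carrier])
    qed
    finally have key: "(B *\<^sub>v ?z) \<bullet> (?R *\<^sub>v ?z)
        = c / real n * (\<Sum>i<n. ?h (pt xs i) z) + lam * (\<Sum>l<d. ?h (unit_vec d l) z)" .
    have "?z = B.A *\<^sub>v (B *\<^sub>v ?z)" by (simp add: B.A_R)
    also have "\<dots> = S *\<^sub>v (B *\<^sub>v ?z) + lam \<cdot>\<^sub>v (B *\<^sub>v ?z)" by (simp add: B.A_mult)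
    finally have "(?R *\<^sub>v ?z) \<bullet> ?z = (?R *\<^sub>v ?z) \<bullet> (S *\<^sub>v (B *\<^sub>v ?z) + lam \<cdot>\<^sub>v (B *\<^sub>v ?z))" by simp
    also have "\<dots> = (?R *\<^sub>v ?z) \<bullet> (S *\<^sub>v (B *\<^sub>v ?z)) + lam * ((?R *\<^sub>v ?z) \<bullet> (B *\<^sub>v ?z))"
      by (simp add: scalar_prod_add_distrib[of _ d] scalar_prod_smult_distrib[of _ d])
    also have "(?R *\<^sub>v ?z) \<bullet> (B *\<^sub>v ?z) = (B *\<^sub>v ?z) \<bullet> (?R *\<^sub>v ?z)" by (rule comm_scalar_prod[of _ d]) auto
    also have "(?R *\<^sub>v ?z) \<bullet> ?z = ?z \<bullet> (?R *\<^sub>v ?z)" by (rule comm_scalar_prod[of _ d]) auto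
    finally show ?thesis unfolding key by simp
  qed
  then have "real n * T {..<n} xs = tau ?R - lam * (c / real n * (\<Sum>i<n. \<integral>z. ?h (pt xs i) z \<partial>P)
      + lam * (\<Sum>l<d. \<integral>z. ?h (unit_vec d l) z \<partial>P))"
    unfolding T_eq_integral tau_def by (simp add: integrable_quad h_int del: S_bilinear)
  also have "\<dots> \<le> tau ?R"
  proof -
    have "0 \<le> lam * (c / real n * (\<Sum>i<n. \<integral>z. ?h (pt xs i) z \<partial>P)
      + lam * (\<Sum>l<d. \<integral>z. ?h (unit_vec d l) z \<partial>P))"
      by (intro mult_nonneg_nonneg add_nonneg_nonneg sum_nonneg h_nonneg divide_nonneg_nonneg)
        (use lam c_ge_1 in auto)
    then show ?thesis by linarith
  qed
  finally show ?thesis using n_pos by (simp add: g_def field_simps)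
qed

text \<open>In \<open>g_minus_D\<close>, replace each \<beta> by T and each \<alpha> by g, collect
  the error in one quantity \<epsilon>, and solve the resulting scalar equation for g - D.\<close>

lemma g_minus_D_abs_le:
  "\<bar>g {..<n} xs - D\<bar> \<le> (1 + c * (\<sigma> / lam)) * (c / real n)
    * (\<Sum>i<n. \<bar>T {..<n} xs - \<beta> xs i\<bar> + \<sigma>\<^sup>2 / lam\<^sup>2 * c * \<bar>g {..<n} xs - \<alpha> xs i\<bar>)"
proof -
  define g' where "g' = g {..<n} xs"
  define T' where "T' = T {..<n} xs"
  define A where "A = 1 + c * g'"
  define \<epsilon> where "\<epsilon> = c / real n * (\<Sum>i<n. T' / A - \<beta> xs i / (1 + c * \<alpha> xs i))"
  have g': "0 \<le> g'" "g' \<le> \<sigma> / lam" "T' \<le> g'" "\<bar>T'\<bar> \<le> \<sigma>\<^sup>2 / lam\<^sup>2"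
    unfolding g'_def T'_def by (rule g_nonneg g_le T_le_g T_abs_le)+
  have pos: "1 \<le> A" using g' c_ge_1 by (simp add: A_def)
  have "\<epsilon> = c / real n * (\<Sum>i<n. T' / A) - c / real n * (\<Sum>i<n. \<beta> xs i / (1 + c * \<alpha> xs i))"
    by (simp only: \<epsilon>_def sum_subtractf right_diff_distrib)
  also have "c / real n * (\<Sum>i<n. T' / A) = c * T' / A" using n_pos by simp
  also have "c / real n * (\<Sum>i<n. \<beta> xs i / (1 + c * \<alpha> xs i)) = T' - (g' - D)"
    using g_minus_D[of xs] unfolding g'_def T'_def by linarith
  finally have "\<epsilon> * A = c * T' / A * A - (T' - (g' - D)) * A"
    by (simp only: left_diff_distrib)
  also have "\<dots> = c * T' - (T' - (g' - D)) * A" using pos by simp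
  \<comment> \<open>The coefficient c - 1 - c D of T' vanishes by the choice of c; the deviation g'
    - D is then the only unknown left.\<close>
  also have "\<dots> = (g' - D) * (1 + c * (g' - T')) + T' * (c - 1 - c * D)"
    unfolding A_def by (simp add: algebra_simps)
  also have "\<dots> = (g' - D) * (1 + c * (g' - T'))" by (simp add: c_D)
  finally have "\<bar>\<epsilon> * A\<bar> = \<bar>(g' - D) * (1 + c * (g' - T'))\<bar>" by (rule arg_cong)
  moreover have "0 \<le> c * (g' - T')" using g' c_ge_1 by simp
  ultimately have "\<bar>\<epsilon>\<bar> * A = \<bar>g' - D\<bar> * (1 + c * (g' - T'))"
    using pos unfolding abs_mult by simp
  \<comment> \<open>\<open>T_le_g\<close> makes the second factor at least 1, so the product
    controls the deviation itself.\<close>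
  moreover have "\<bar>g' - D\<bar> * 1 \<le> \<bar>g' - D\<bar> * (1 + c * (g' - T'))"
    using g' c_ge_1 by (intro mult_left_mono) auto
  ultimately have "\<bar>g' - D\<bar> \<le> A * \<bar>\<epsilon>\<bar>" by (simp add: mult.commute)
  also have "\<dots> \<le> (1 + c * (\<sigma> / lam)) * \<bar>\<epsilon>\<bar>"
    unfolding A_def using g' c_ge_1 by (intro mult_right_mono add_left_mono mult_left_mono) auto
  also have "\<bar>\<epsilon>\<bar> \<le> c / real n * (\<Sum>i<n. \<bar>T' - \<beta> xs i\<bar> + \<sigma>\<^sup>2 / lam\<^sup>2 * c * \<bar>g' - \<alpha> xs i\<bar>)"
  proof -
    have "\<bar>T' / A - \<beta> xs i / (1 + c * \<alpha> xs i)\<bar>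
        \<le> \<bar>T' - \<beta> xs i\<bar> + \<sigma>\<^sup>2 / lam\<^sup>2 * c * \<bar>g' - \<alpha> xs i\<bar>" for i
    proof -
      define a where "a = 1 + c * \<alpha> xs i"
      have a: "1 \<le> a" using one_plus_c\<alpha>_pos[of xs i] by (simp add: a_def)
      have "T' / A - \<beta> xs i / a = (T' - \<beta> xs i) / a + T' * (a - A) / (A * a)"
        using a pos by (simp add: field_simps)
      also have "a - A = c * (\<alpha> xs i - g')" by (simp add: a_def A_def algebra_simps)
      also have "\<bar>(T' - \<beta> xs i) / a + T' * (c * (\<alpha> xs i - g')) / (A * a)\<bar>
          \<le> \<bar>T' - \<beta> xs i\<bar> / a + \<bar>T'\<bar> * (c * \<bar>\<alpha> xs i - g'\<bar>) / (A * a)"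
        using a pos c_ge_1 by (intro order_trans[OF abs_triangle_ineq]) (simp add: abs_mult)
      also have "\<dots> \<le> \<bar>T' - \<beta> xs i\<bar> / 1 + \<sigma>\<^sup>2 / lam\<^sup>2 * (c * \<bar>\<alpha> xs i - g'\<bar>) / 1"
        using a pos c_ge_1 g' mult_mono[OF pos a]
        by (intro add_mono frac_le mult_right_mono mult_nonneg_nonneg) auto
      also have "\<dots> = \<bar>T' - \<beta> xs i\<bar> + \<sigma>\<^sup>2 / lam\<^sup>2 * c * \<bar>g' - \<alpha> xs i\<bar>"
        by (simp add: abs_minus_commute)
      finally show ?thesis by (simp only: a_def)
    qed
    then show ?thesis
      unfolding \<epsilon>_def abs_mult using c_ge_1
      by (intro mult_mono order_trans[OF sum_abs] sum_mono) (auto intro!: sum_nonneg)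
  qed
  finally show ?thesis
    using c_ge_1 \<sigma>_pos lam by (simp add: g'_def T'_def mult.assoc mult_left_mono)
qed

section \<open>Averaging over the sample\<close>

abbreviation "Q \<equiv> PiM {..<n} (\<lambda>_. P)"

sublocale PS: product_sigma_finite "\<lambda>_. P"
  by (simp add: product_sigma_finite_def sigma_finite_measure_axioms)

sublocale Q: prob_space Q
  by (rule prob_space_PiM) (rule prob_space_axioms)

lemma insert_others: "i < n \<Longrightarrow> insert i (others i) = {..<n}"
  by auto

lemma prob_space_others: "prob_space (PiM (others i) (\<lambda>_. P))"
  by (rule prob_space_PiM) (rule prob_space_axioms)

lemma measurable_sample [measurable]:
  "i < n \<Longrightarrow> j < d \<Longrightarrow> (\<lambda>xs. xs i j) \<in> borel_measurable Q"
  using measurable_compose[OF measurable_component_singleton[of i "{..<n}" "\<lambda>_. P"] measurable_coord[of j]]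
  by simp

lemma measurable_R [measurable]:
  assumes J: "J \<subseteq> {..<n}" and jk: "j < d" "k < d"
  shows "(\<lambda>xs. R J xs $$ (j, k)) \<in> borel_measurable Q"
proof (rule borel_measurable_left_inverse[OF _ _ _ _ _ jk])
  show "G J xs + lam \<cdot>\<^sub>m 1\<^sub>m d \<in> carrier_mat d d" for xs by simp
  show "R J xs \<in> carrier_mat d d" for xs by simp
  show "R J xs * (G J xs + lam \<cdot>\<^sub>m 1\<^sub>m d) = 1\<^sub>m d" for xs
    using ridge.R_props(2)[OF ridge_G] by (simp add: R_def)
  show "det (G J xs + lam \<cdot>\<^sub>m 1\<^sub>m d) \<noteq> 0" for xs by (rule ridge.det_A[OF ridge_G])
  fix a b assume ab: "a < d" "b < d"
  have "(\<lambda>xs. \<Sum>i\<in>J. xs i a * xs i b) \<in> borel_measurable Q"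
    using J ab by (intro borel_measurable_sum borel_measurable_times measurable_sample) auto
  then show "(\<lambda>xs. (G J xs + lam \<cdot>\<^sub>m 1\<^sub>m d) $$ (a, b)) \<in> borel_measurable Q"
    using ab by (simp add: G_def)
qed

lemma measurable_BSR [measurable]:
  assumes "J \<subseteq> {..<n}" "j < d" "k < d"
  shows "(\<lambda>xs. (B * S * R J xs) $$ (j, k)) \<in> borel_measurable Q"
proof -
  have "(B * S * R J xs) $$ (j, k) = (\<Sum>l<d. (B * S) $$ (j, l) * R J xs $$ (l, k))" for xs
    using assms carrier_matD[OF BS_carrier(1)] carrier_matD[OF R_facts(1)[of J xs]]
    by (subst index_mult_mat) (simp_all add: scalar_prod_def atLeast0LessThan del: index_mult_mat)
  then show ?thesis using assms by simp
qed

lemma measurable_mult_vec: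
  assumes "J \<subseteq> {..<n}" "v \<in> carrier_vec d" "j < d"
  shows "(\<lambda>xs. (R J xs *\<^sub>v v) $ j) \<in> borel_measurable Q"
proof -
  have "(R J xs *\<^sub>v v) $ j = (\<Sum>k<d. R J xs $$ (j, k) * v $ k)" for xs
    using assms carrier_matD[OF R_facts(1)[of J xs]] by (simp add: scalar_prod_def atLeast0LessThan)
  then show ?thesis using assms by simp
qed

lemma measurable_quad_sample:
  assumes "\<And>xs. W xs \<in> carrier_mat d d"
    and "\<And>j k. j < d \<Longrightarrow> k < d \<Longrightarrow> (\<lambda>xs. W xs $$ (j, k)) \<in> borel_measurable Q" and "i < n"
  shows "(\<lambda>xs. pt xs i \<bullet> (W xs *\<^sub>v pt xs i)) \<in> borel_measurable Q"
  using assms by (simp add: quad_form_eq_sum)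

lemma measurable_tau:
  assumes "\<And>xs. W xs \<in> carrier_mat d d"
    and "\<And>j k. j < d \<Longrightarrow> k < d \<Longrightarrow> (\<lambda>xs. W xs $$ (j, k)) \<in> borel_measurable Q"
  shows "(\<lambda>xs. tau (W xs)) \<in> borel_measurable Q"
  using assms by (simp add: tau_eq_sum)

lemma measurable_linear_sample:
  assumes "\<And>xs. a xs \<in> carrier_vec d" "\<And>j. j < d \<Longrightarrow> (\<lambda>xs. a xs $ j) \<in> borel_measurable Q" "i < n"
  shows "(\<lambda>xs. a xs \<bullet> pt xs i) \<in> borel_measurable Q"
  using assms by (simp add: scalar_prod_def)

lemma measurable_bilinear_R:
  assumes "J \<subseteq> {..<n}" "u \<in> carrier_vec d" "v \<in> carrier_vec d"
  shows "(\<lambda>xs. u \<bullet> (R J xs *\<^sub>v v)) \<in> borel_measurable Q"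
  unfolding bilinear_eq_sum[OF R_facts(1) assms(2,3)] using assms(1) by simp

lemma measurable_statistics [measurable]:
  "i < n \<Longrightarrow> (\<lambda>xs. \<alpha> xs i) \<in> borel_measurable Q" "i < n \<Longrightarrow> (\<lambda>xs. \<beta> xs i) \<in> borel_measurable Q"
  "J \<subseteq> {..<n} \<Longrightarrow> g J \<in> borel_measurable Q" "J \<subseteq> {..<n} \<Longrightarrow> T J \<in> borel_measurable Q"
proof -
  show "i < n \<Longrightarrow> (\<lambda>xs. \<alpha> xs i) \<in> borel_measurable Q" "i < n \<Longrightarrow> (\<lambda>xs. \<beta> xs i) \<in> borel_measurable Q"
    unfolding \<alpha>_def \<beta>_def
    by (auto intro!: borel_measurable_divide measurable_quad_sample measurable_R measurable_BSR)
  show "J \<subseteq> {..<n} \<Longrightarrow> g J \<in> borel_measurable Q" "J \<subseteq> {..<n} \<Longrightarrow> T J \<in> borel_measurable Q"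
    unfolding g_def[abs_def] T_def[abs_def]
    by (auto intro!: borel_measurable_divide measurable_tau measurable_R measurable_BSR)
qed

section \<open>Conditioning on the other observations\<close>

text \<open>Integrate coordinate i first: a conditional bound uniform in the other coordinates
  passes to the whole sample. The nonnegative integral is used because integrability over Q is
  itself part of the claim.\<close>

lemma
  fixes f :: "(nat \<Rightarrow> nat \<Rightarrow> real) \<Rightarrow> real"
  assumes i: "i < n" and f [measurable]: "f \<in> borel_measurable Q" and nonneg: "\<And>xs. 0 \<le> f xs"
    and K: "0 \<le> K"
    and int: "\<And>xs. integrable P (\<lambda>x. f (xs(i := x)))"
    and le: "\<And>xs. (\<integral>x. f (xs(i := x)) \<partial>P) \<le> K"
  shows integrable_conditional: "integrable Q f" and integral_conditional_le: "(\<integral>xs. f xs \<partial>Q) \<le> K"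
proof -
  interpret O: prob_space "PiM (others i) (\<lambda>_. P)" by (rule prob_space_others)
  have "(\<integral>\<^sup>+xs. ennreal (f xs) \<partial>Q)
      = (\<integral>\<^sup>+xs. (\<integral>\<^sup>+x. ennreal (f (xs(i := x))) \<partial>P) \<partial>PiM (others i) (\<lambda>_. P))"
    using PS.product_nn_integral_insert[of "others i" i "\<lambda>xs. ennreal (f xs)", unfolded insert_others[OF i]]
    by simp
  also have "\<dots> \<le> (\<integral>\<^sup>+xs. ennreal K \<partial>PiM (others i) (\<lambda>_. P))"
    using nn_integral_eq_integral[OF int] le nonneg by (intro nn_integral_mono) (auto intro!: ennreal_leI)
  also have "\<dots> = ennreal K" by (simp add: O.emeasure_space_1)
  finally have *: "(\<integral>\<^sup>+xs. ennreal (f xs) \<partial>Q) \<le> ennreal K" .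
  show 1: "integrable Q f"
    by (rule integrableI_bounded) (use * nonneg in \<open>auto simp: order_le_less_trans[OF _ ennreal_less_top]\<close>)
  show "(\<integral>xs. f xs \<partial>Q) \<le> K"
    using * nn_integral_eq_integral[OF 1] nonneg K by simp
qed

lemma integral_conditional_0:
  fixes f :: "(nat \<Rightarrow> nat \<Rightarrow> real) \<Rightarrow> real"
  assumes i: "i < n" and f: "integrable Q f" and 0: "\<And>xs. (\<integral>x. f (xs(i := x)) \<partial>P) = 0"
  shows "(\<integral>xs. f xs \<partial>Q) = 0"
  using PS.product_integral_insert[of "others i" i f, unfolded insert_others[OF i]] f 0 by simp

text \<open>The form in which independence of x_i and its leave-one-out resolvent is used: under the
  product measure that resolvent is constant in coordinate i.\<close>

lemma R_others_upd [simp]: "R (others i) (xs(i := x)) = R (others i) xs"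
proof -
  have "G (others i) (xs(i := x)) = G (others i) xs"
    by (rule eq_matI) (auto simp: G_def intro!: sum.cong)
  then show ?thesis by (simp add: R_def)
qed

text \<open>With the other observations frozen, W is a fixed matrix and \<open>quad_variance\<close>
  applies. The factor (d / n)^2 <= 1 absorbs the passage from normalisation by d to normalisation by
  n.\<close>

lemma
  assumes i: "i < n" and W: "\<And>xs. op_bound d (W xs) K"
    and W_meas: "\<And>j k. j < d \<Longrightarrow> k < d \<Longrightarrow> (\<lambda>xs. W xs $$ (j, k)) \<in> borel_measurable Q"
    and W_upd: "\<And>xs x. W (xs(i := x)) = W xs"
  shows integrable_quad_sample: "integrable Q (\<lambda>xs. (pt xs i \<bullet> (W xs *\<^sub>v pt xs i) / real n - tau (W xs) / real n)\<^sup>2)"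
    and integral_quad_sample: "(\<integral>xs. (pt xs i \<bullet> (W xs *\<^sub>v pt xs i) / real n - tau (W xs) / real n)\<^sup>2 \<partial>Q) \<le> \<nu> * K\<^sup>2"
proof -
  let ?f = "\<lambda>xs. (pt xs i \<bullet> (W xs *\<^sub>v pt xs i) / real n - tau (W xs) / real n)\<^sup>2"
  have Wc: "W xs \<in> carrier_mat d d" for xs by (rule op_boundD[OF W])
  have meas: "?f \<in> borel_measurable Q"
    by (intro borel_measurable_power borel_measurable_diff borel_measurable_divide
        measurable_quad_sample[OF Wc W_meas i] measurable_tau[OF Wc W_meas]) auto
  have eq: "?f (xs(i := x)) = (vec d x \<bullet> (W xs *\<^sub>v vec d x) - tau (W xs))\<^sup>2 / (real n)\<^sup>2" for xs x
    by (simp add: W_upd diff_divide_distrib[symmetric] power_divide)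
  have int: "integrable P (\<lambda>x. ?f (xs(i := x)))" for xs
    unfolding eq using integrable_quad_centered_sq[OF Wc] by simp
  have le: "(\<integral>x. ?f (xs(i := x)) \<partial>P) \<le> \<nu> * K\<^sup>2" for xs
  proof -
    have "(\<integral>x. ?f (xs(i := x)) \<partial>P) \<le> \<nu> * (real d)\<^sup>2 * K\<^sup>2 / (real n)\<^sup>2"
      unfolding eq using quad_variance[OF W] by (simp add: divide_right_mono)
    also have "\<dots> = \<nu> * K\<^sup>2 * (real d / real n)\<^sup>2" by (simp add: power_divide)
    also have "\<dots> \<le> \<nu> * K\<^sup>2 * 1"
      using d_over_n \<nu>_nonneg by (intro mult_left_mono) (auto intro!: power_le_one)
    finally show ?thesis by simp
  qed
  show "integrable Q ?f" "(\<integral>xs. ?f xs \<partial>Q) \<le> \<nu> * K\<^sup>2"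
    using integrable_conditional[OF i meas _ _ int le] integral_conditional_le[OF i meas _ _ int le] \<nu>_nonneg
    by auto
qed

lemma
  assumes i: "i < n"
  shows integrable_\<alpha>_sq: "integrable Q (\<lambda>xs. (\<alpha> xs i - g (others i) xs)\<^sup>2)"
    and integral_\<alpha>_sq: "(\<integral>xs. (\<alpha> xs i - g (others i) xs)\<^sup>2 \<partial>Q) \<le> (sqrt \<nu> / lam)\<^sup>2"
    and integrable_\<beta>_sq: "integrable Q (\<lambda>xs. (\<beta> xs i - T (others i) xs)\<^sup>2)"
    and integral_\<beta>_sq: "(\<integral>xs. (\<beta> xs i - T (others i) xs)\<^sup>2 \<partial>Q) \<le> (sqrt \<nu> * \<sigma> / lam\<^sup>2)\<^sup>2"
proof -
  have o: "others i \<subseteq> {..<n}" by auto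
  have sq: "(sqrt \<nu>)\<^sup>2 = \<nu>" using \<nu>_nonneg by simp
  show "integrable Q (\<lambda>xs. (\<alpha> xs i - g (others i) xs)\<^sup>2)"
    "(\<integral>xs. (\<alpha> xs i - g (others i) xs)\<^sup>2 \<partial>Q) \<le> (sqrt \<nu> / lam)\<^sup>2"
    using integrable_quad_sample[OF i R_bound measurable_R[OF o]] integral_quad_sample[OF i R_bound measurable_R[OF o]]
    by (simp_all add: \<alpha>_def g_def power_divide sq)
  show "integrable Q (\<lambda>xs. (\<beta> xs i - T (others i) xs)\<^sup>2)"
    "(\<integral>xs. (\<beta> xs i - T (others i) xs)\<^sup>2 \<partial>Q) \<le> (sqrt \<nu> * \<sigma> / lam\<^sup>2)\<^sup>2"
    using integrable_quad_sample[OF i BSR_bound measurable_BSR[OF o]] integral_quad_sample[OF i BSR_bound measurable_BSR[OF o]]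
    by (simp_all add: \<beta>_def T_def power_divide power_mult_distrib sq)
qed

lemma
  assumes i: "i < n"
    and a: "\<And>xs. a xs \<in> carrier_vec d" "\<And>xs. vnorm (a xs) \<le> Ka" "\<And>xs x. a (xs(i := x)) = a xs"
      "\<And>j. j < d \<Longrightarrow> (\<lambda>xs. a xs $ j) \<in> borel_measurable Q"
    and b: "\<And>xs. b xs \<in> carrier_vec d" "\<And>xs. vnorm (b xs) \<le> Kb" "\<And>xs x. b (xs(i := x)) = b xs"
      "\<And>j. j < d \<Longrightarrow> (\<lambda>xs. b xs $ j) \<in> borel_measurable Q"
  shows integrable_linear_sample: "integrable Q (\<lambda>xs. ((a xs \<bullet> pt xs i) * (b xs \<bullet> pt xs i))\<^sup>2)"
    and integral_linear_sample:
      "(\<integral>xs. ((a xs \<bullet> pt xs i) * (b xs \<bullet> pt xs i))\<^sup>2 \<partial>Q) \<le> (sqrt m * Ka * Kb)\<^sup>2"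
proof -
  let ?f = "\<lambda>xs. ((a xs \<bullet> pt xs i) * (b xs \<bullet> pt xs i))\<^sup>2"
  have meas: "?f \<in> borel_measurable Q"
    by (intro borel_measurable_power borel_measurable_times measurable_linear_sample[OF a(1,4) i]
        measurable_linear_sample[OF b(1,4) i]) auto
  have eq: "?f (xs(i := x)) = (a xs \<bullet> vec d x)\<^sup>2 * (b xs \<bullet> vec d x)\<^sup>2" for xs x
    by (simp add: a b power_mult_distrib)
  have int: "integrable P (\<lambda>x. ?f (xs(i := x)))" for xs
    unfolding eq by (rule integrable_linear_sq[OF a(1) b(1)])
  have le: "(\<integral>x. ?f (xs(i := x)) \<partial>P) \<le> (sqrt m * Ka * Kb)\<^sup>2" for xs
  proof -
    have "(\<integral>x. ?f (xs(i := x)) \<partial>P) \<le> m * (vnorm (a xs))\<^sup>2 * (vnorm (b xs))\<^sup>2"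
      unfolding eq by (rule integral_linear_sq[OF a(1) b(1)])
    also have "\<dots> \<le> m * Ka\<^sup>2 * Kb\<^sup>2"
      using a(2)[of xs] b(2)[of xs] m_nonneg
      by (intro mult_mono power_mono) (auto intro!: mult_nonneg_nonneg)
    finally show ?thesis using m_nonneg by (simp add: power_mult_distrib)
  qed
  show "integrable Q ?f" "(\<integral>xs. ?f xs \<partial>Q) \<le> (sqrt m * Ka * Kb)\<^sup>2"
    using integrable_conditional[OF i meas _ _ int le] integral_conditional_le[OF i meas _ _ int le]
    by auto
qed

section \<open>Mean deviations of g and \<alpha> from D\<close>

lemma integral_g_minus_D:
  shows "integrable Q (\<lambda>xs. \<bar>g {..<n} xs - D\<bar>)"
    and "(\<integral>xs. \<bar>g {..<n} xs - D\<bar> \<partial>Q) \<le> err1 \<sigma> lam c (sqrt \<nu>) (1 / real n)"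
proof -
  let ?e = "1 / real n" and ?s = "sqrt \<nu>"
  have s_nonneg: "0 \<le> ?s" using \<nu>_nonneg by simp
  show 1: "integrable Q (\<lambda>xs. \<bar>g {..<n} xs - D\<bar>)"
  proof (rule integrable_bounded_by[where K = "\<sigma> / lam + \<sigma> / lam"])
    show "\<bar>\<bar>g {..<n} xs - D\<bar>\<bar> \<le> \<sigma> / lam + \<sigma> / lam" for xs
      using g_nonneg[of "{..<n}" xs] g_le[of "{..<n}" xs] D_nonneg D_le by linarith
    show "finite_measure Q" by (rule Q.finite_measure_axioms)
  qed simp
  \<comment> \<open>Concentration is available around the leave-one-out \<open>T\<close> and
    \<open>g\<close> only; passing to them from the full-sample ones adds the terms with 1 /
    n.\<close>
  let ?h = "\<lambda>i xs. (\<bar>\<beta> xs i - T (others i) xs\<bar> + \<sigma>\<^sup>2 / lam\<^sup>2 * ?e)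
      + \<sigma>\<^sup>2 / lam\<^sup>2 * c * (\<bar>\<alpha> xs i - g (others i) xs\<bar> + \<sigma> / lam * ?e)"
  have le: "\<bar>T {..<n} xs - \<beta> xs i\<bar> + \<sigma>\<^sup>2 / lam\<^sup>2 * c * \<bar>g {..<n} xs - \<alpha> xs i\<bar> \<le> ?h i xs"
    if "i < n" for i xs
  proof (intro add_mono mult_left_mono)
    show "\<bar>T {..<n} xs - \<beta> xs i\<bar> \<le> \<bar>\<beta> xs i - T (others i) xs\<bar> + \<sigma>\<^sup>2 / lam\<^sup>2 * ?e"
      using T_perturb[OF that, of xs] by simp
    show "\<bar>g {..<n} xs - \<alpha> xs i\<bar> \<le> \<bar>\<alpha> xs i - g (others i) xs\<bar> + \<sigma> / lam * ?e"
      using g_perturb[OF that, of xs] by simp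
  qed (use c_ge_1 in auto)
  have L1: "integrable Q (\<lambda>xs. \<beta> xs i - T (others i) xs)"
      "(\<integral>xs. \<bar>\<beta> xs i - T (others i) xs\<bar> \<partial>Q) \<le> ?s * \<sigma> / lam\<^sup>2"
      "integrable Q (\<lambda>xs. \<alpha> xs i - g (others i) xs)"
      "(\<integral>xs. \<bar>\<alpha> xs i - g (others i) xs\<bar> \<partial>Q) \<le> ?s / lam" if i: "i < n" for i
  proof -
    have o: "others i \<subseteq> {..<n}" by auto
    have meas: "(\<lambda>xs. \<beta> xs i - T (others i) xs) \<in> borel_measurable Q"
        "(\<lambda>xs. \<alpha> xs i - g (others i) xs) \<in> borel_measurable Q"
      using i o by simp_all
    have nonneg: "0 \<le> ?s * \<sigma> / lam\<^sup>2" "0 \<le> ?s / lam" using s_nonneg \<sigma>_pos lam by auto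
    show "integrable Q (\<lambda>xs. \<beta> xs i - T (others i) xs)"
      "(\<integral>xs. \<bar>\<beta> xs i - T (others i) xs\<bar> \<partial>Q) \<le> ?s * \<sigma> / lam\<^sup>2"
      using Q.integrable_of_L2[OF meas(1) integrable_\<beta>_sq[OF i] integral_\<beta>_sq[OF i] nonneg(1)]
        Q.integral_abs_le_L2[OF meas(1) integrable_\<beta>_sq[OF i] integral_\<beta>_sq[OF i] nonneg(1)] by auto
    show "integrable Q (\<lambda>xs. \<alpha> xs i - g (others i) xs)"
      "(\<integral>xs. \<bar>\<alpha> xs i - g (others i) xs\<bar> \<partial>Q) \<le> ?s / lam"
      using Q.integrable_of_L2[OF meas(2) integrable_\<alpha>_sq[OF i] integral_\<alpha>_sq[OF i] nonneg(2)]
        Q.integral_abs_le_L2[OF meas(2) integrable_\<alpha>_sq[OF i] integral_\<alpha>_sq[OF i] nonneg(2)] by auto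
  qed
  let ?k = "(?s * \<sigma> / lam\<^sup>2 + \<sigma>\<^sup>2 / lam\<^sup>2 * ?e) + \<sigma>\<^sup>2 / lam\<^sup>2 * c * (?s / lam + \<sigma> / lam * ?e)"
  have h: "integrable Q (?h i)" "(\<integral>xs. ?h i xs \<partial>Q) \<le> ?k" if i: "i < n" for i
  proof -
    note L = L1[OF i]
    show "integrable Q (?h i)" using L by auto
    have "(\<integral>xs. ?h i xs \<partial>Q) = ((\<integral>xs. \<bar>\<beta> xs i - T (others i) xs\<bar> \<partial>Q) + \<sigma>\<^sup>2 / lam\<^sup>2 * ?e)
        + \<sigma>\<^sup>2 / lam\<^sup>2 * c * ((\<integral>xs. \<bar>\<alpha> xs i - g (others i) xs\<bar> \<partial>Q) + \<sigma> / lam * ?e)"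
      using L by (simp add: Q.prob_space)
    also have "\<dots> \<le> ?k"
      using L c_ge_1 \<sigma>_pos lam by (intro add_mono mult_left_mono) auto
    finally show "(\<integral>xs. ?h i xs \<partial>Q) \<le> ?k" .
  qed
  let ?C = "(1 + c * (\<sigma> / lam)) * (c / real n)"
  have C_nonneg: "0 \<le> ?C" using c_ge_1 \<sigma>_pos lam by auto
  have "(\<integral>xs. \<bar>g {..<n} xs - D\<bar> \<partial>Q) \<le> (\<integral>xs. ?C * (\<Sum>i<n. ?h i xs) \<partial>Q)"
  proof (rule integral_mono[OF 1])
    show "integrable Q (\<lambda>xs. ?C * (\<Sum>i<n. ?h i xs))"
      by (intro integrable_mult_right Bochner_Integration.integrable_sum h) simp
    show "\<bar>g {..<n} xs - D\<bar> \<le> ?C * (\<Sum>i<n. ?h i xs)" for xs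
      by (rule order_trans[OF g_minus_D_abs_le]) (intro mult_left_mono C_nonneg sum_mono le, simp)
  qed
  also have "\<dots> = ?C * (\<Sum>i<n. \<integral>xs. ?h i xs \<partial>Q)"
    using h(1) by (subst integral_mult_right_zero, subst Bochner_Integration.integral_sum) auto
  also have "\<dots> \<le> ?C * (\<Sum>i<n. ?k)"
    using h(2) by (intro mult_left_mono C_nonneg sum_mono) auto
  also have "\<dots> = err1 \<sigma> lam c ?s ?e"
    using n_pos by (simp add: err1_def mult.assoc)
  finally show "(\<integral>xs. \<bar>g {..<n} xs - D\<bar> \<partial>Q) \<le> err1 \<sigma> lam c ?s ?e" .
qed

text \<open>Split \<alpha> - D at the leave-one-out g. The second part q needs a second moment,
  while only a first moment of g - D is at hand; boundedness of g and D closes the gap.\<close>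

lemma
  assumes i: "i < n"
  shows integrable_\<alpha>_minus_D_sq: "integrable Q (\<lambda>xs. (\<alpha> xs i - D)\<^sup>2)"
    and integral_\<alpha>_minus_D_sq: "(\<integral>xs. (\<alpha> xs i - D)\<^sup>2 \<partial>Q) \<le> err2 \<sigma> lam c (sqrt \<nu>) (1 / real n)"
proof -
  let ?e = "1 / real n" and ?s = "sqrt \<nu>"
  let ?h = "\<lambda>xs. 2 * (\<alpha> xs i - g (others i) xs)\<^sup>2
      + 2 * (\<sigma> / lam * (\<bar>g {..<n} xs - D\<bar> + \<sigma> / lam * ?e))"
  have le: "(\<alpha> xs i - D)\<^sup>2 \<le> ?h xs" for xs
  proof -
    define p where "p = \<alpha> xs i - g (others i) xs"
    define q where "q = g (others i) xs - D"
    have "\<bar>q\<bar> \<le> \<sigma> / lam"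
      using g_nonneg[of "others i" xs] g_le[of "others i" xs] D_nonneg D_le by (auto simp: q_def abs_le_iff)
    moreover have "\<bar>q\<bar> \<le> \<bar>g {..<n} xs - D\<bar> + \<sigma> / lam * ?e"
      using g_perturb[OF i, of xs] by (simp add: q_def)
    \<comment> \<open>One factor is bounded by \<sigma> / lam, as g and D both lie between 0 and
      \<sigma> / lam; the other by its distance through the full-sample g.\<close>
    ultimately have "\<bar>q\<bar> * \<bar>q\<bar> \<le> \<sigma> / lam * (\<bar>g {..<n} xs - D\<bar> + \<sigma> / lam * ?e)"
      by (intro mult_mono) auto
    moreover have "(p + q)\<^sup>2 \<le> 2 * p\<^sup>2 + 2 * (\<bar>q\<bar> * \<bar>q\<bar>)"
      using zero_le_power2[of "p - q"] by (simp add: power2_eq_square algebra_simps)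
    ultimately have "(p + q)\<^sup>2 \<le> 2 * p\<^sup>2 + 2 * (\<sigma> / lam * (\<bar>g {..<n} xs - D\<bar> + \<sigma> / lam * ?e))"
      by linarith
    then show ?thesis by (simp add: p_def q_def)
  qed
  have int: "integrable Q ?h"
    using integrable_\<alpha>_sq[OF i] integral_g_minus_D(1) by auto
  show int': "integrable Q (\<lambda>xs. (\<alpha> xs i - D)\<^sup>2)"
    by (rule integrable_dominated[OF int]) (use i le in simp_all)
  have "(\<integral>xs. (\<alpha> xs i - D)\<^sup>2 \<partial>Q) \<le> (\<integral>xs. ?h xs \<partial>Q)"
    by (rule integral_mono[OF int' int le])
  also have "\<dots> = 2 * (\<integral>xs. (\<alpha> xs i - g (others i) xs)\<^sup>2 \<partial>Q)
      + 2 * (\<sigma> / lam * ((\<integral>xs. \<bar>g {..<n} xs - D\<bar> \<partial>Q) + \<sigma> / lam * ?e))"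
    using integrable_\<alpha>_sq[OF i] integral_g_minus_D(1) by (simp add: Q.prob_space)
  also have "\<dots> \<le> err2 \<sigma> lam c ?s ?e"
    unfolding err2_def using integral_\<alpha>_sq[OF i] integral_g_minus_D(2) \<sigma>_pos lam
    by (intro add_mono mult_left_mono) auto
  finally show "(\<integral>xs. (\<alpha> xs i - D)\<^sup>2 \<partial>Q) \<le> err2 \<sigma> lam c ?s ?e" .
qed

section \<open>The mean resolvent between two unit vectors\<close>

lemma integral_resolvent_diff:
  assumes u: "u \<in> carrier_vec d" "vnorm u = 1" and v: "v \<in> carrier_vec d" "vnorm v = 1"
  shows "\<bar>(\<integral>xs. u \<bullet> (R {..<n} xs *\<^sub>v v) \<partial>Q) - u \<bullet> (B *\<^sub>v v)\<bar> \<le> err \<sigma> m lam c (sqrt \<nu>) (1 / real n)"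
proof -
  let ?e = "1 / real n"
  define w where "w = B *\<^sub>v v"
  define y where "y = S *\<^sub>v w"
  have w: "w \<in> carrier_vec d" "vnorm w \<le> 1 / lam"
    using op_boundD(3)[OF B.R_bound v(1)] v by (auto simp: w_def)
  have y: "y \<in> carrier_vec d" "vnorm y \<le> \<sigma> / lam"
    using op_boundD(3)[OF BS_bound, of w] op_boundD(3)[OF S_bound w(1)] w \<sigma>_pos lam
      mult_left_mono[OF w(2), of \<sigma>] by (auto simp: y_def)
  let ?a = "\<lambda>i xs. R (others i) xs *\<^sub>v u"
  let ?b = "\<lambda>i xs. R (others i) xs *\<^sub>v y"
  have a: "vnorm (?a i xs) \<le> 1 / lam" for i xs
    using op_boundD(3)[OF R_bound u(1), of "others i" xs] u by simp
  have b: "vnorm (?b i xs) \<le> \<sigma> / lam\<^sup>2" for i xs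
    using order_trans[OF op_boundD(3)[OF R_bound y(1), of "others i" xs] mult_left_mono[OF y(2)]] lam
    by (simp add: power2_eq_square)
  \<comment> \<open>Three sources of error per observation: \<open>?t1\<close> replaces R by the
    leave-one-out resolvent, \<open>?t2\<close> replaces S by x_i x_i^T, and \<open>?t3\<close>
    replaces c / (1 + c \<alpha>) by 1.\<close>
  let ?t1 = "\<lambda>i xs. u \<bullet> (R {..<n} xs *\<^sub>v y) - u \<bullet> (R (others i) xs *\<^sub>v y)"
  let ?t2 = "\<lambda>i xs. u \<bullet> (R (others i) xs *\<^sub>v y) - (?a i xs \<bullet> pt xs i) * (w \<bullet> pt xs i)"
  let ?t3 = "\<lambda>i xs. ((?a i xs \<bullet> pt xs i) * (w \<bullet> pt xs i)) * (c * (\<alpha> xs i - D) / (1 + c * \<alpha> xs i))"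
  have split: "u \<bullet> (R {..<n} xs *\<^sub>v v) - u \<bullet> (B *\<^sub>v v)
      = 1 / real n * (\<Sum>i<n. ?t1 i xs + ?t2 i xs + ?t3 i xs)" for xs
  proof -
    have summand: "u \<bullet> (R {..<n} xs *\<^sub>v y) - c * (((R {..<n} xs *\<^sub>v u) \<bullet> pt xs i) * (pt xs i \<bullet> w))
        = ?t1 i xs + ?t2 i xs + ?t3 i xs" if i: "i < n" for i
    proof -
      define p where "p = (?a i xs \<bullet> pt xs i) * (w \<bullet> pt xs i)"
      define A where "A = 1 + c * \<alpha> xs i"
      have A: "1 \<le> A" using one_plus_c\<alpha>_pos[of xs i] by (simp add: A_def)
      have "(R {..<n} xs *\<^sub>v u) \<bullet> pt xs i = u \<bullet> (R {..<n} xs *\<^sub>v pt xs i)"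
        using u by (simp add: R_sym)
      also have "\<dots> = (?a i xs \<bullet> pt xs i) / A"
        using u i by (simp add: R_pt R_sym A_def)
      finally have "((R {..<n} xs *\<^sub>v u) \<bullet> pt xs i) * (pt xs i \<bullet> w) = p / A"
        using w by (simp add: p_def pt_scalar_commute)
      moreover have "p - c * (p / A) = p * ((A - c) / A)"
        using A by (simp add: field_simps)
      \<comment> \<open>1 + c D = c turns the defect of the factor c / A from 1 into a multiple of
        \<alpha> - D.\<close>
      moreover have "A - c = c * (\<alpha> xs i - D)"
        using c_D by (simp add: A_def algebra_simps)
      ultimately show ?thesis by (simp add: p_def A_def)
    qed
    have "u \<bullet> (R {..<n} xs *\<^sub>v v) - u \<bullet> (B *\<^sub>v v)
        = u \<bullet> (R {..<n} xs *\<^sub>v y) - c / real n * (\<Sum>i<n. ((R {..<n} xs *\<^sub>v u) \<bullet> pt xs i) * (pt xs i \<bullet> w))"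
      using resolvent_identity[OF ridge_G[of "{..<n}" xs] B.ridge_axioms u(1) v(1), folded R_def] u w y
      by (simp add: G_bilinear R_sym flip: w_def y_def)
    also have "\<dots> = 1 / real n * (\<Sum>i<n. u \<bullet> (R {..<n} xs *\<^sub>v y)
        - c * (((R {..<n} xs *\<^sub>v u) \<bullet> pt xs i) * (pt xs i \<bullet> w)))"
      using n_pos by (simp add: sum_subtractf sum_distrib_left right_diff_distrib sum_divide_distrib)
    also have "\<dots> = 1 / real n * (\<Sum>i<n. ?t1 i xs + ?t2 i xs + ?t3 i xs)"
      by (intro arg_cong2[where f = times] sum.cong refl summand) simp
    finally show ?thesis .
  qed
  have bilin_int: "integrable Q (\<lambda>xs. u \<bullet> (R J xs *\<^sub>v z))" if "J \<subseteq> {..<n}" "z \<in> carrier_vec d" for J z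
    using op_bound_bilinear[OF R_bound u(1) that(2)]
    by (intro integrable_bounded_by[OF measurable_bilinear_R[OF that(1) u(1) that(2)] _ Q.finite_measure_axioms])
  have o: "others i \<subseteq> {..<n}" for i by auto
  have a_meas: "j < d \<Longrightarrow> (\<lambda>xs. ?a i xs $ j) \<in> borel_measurable Q"
    and b_meas: "j < d \<Longrightarrow> (\<lambda>xs. ?b i xs $ j) \<in> borel_measurable Q" for i j
    using measurable_mult_vec[OF o u(1)] measurable_mult_vec[OF o y(1)] by auto
  have pq: "integrable Q (\<lambda>xs. ((?a i xs \<bullet> pt xs i) * (w \<bullet> pt xs i))\<^sup>2)"
      "(\<integral>xs. ((?a i xs \<bullet> pt xs i) * (w \<bullet> pt xs i))\<^sup>2 \<partial>Q) \<le> (sqrt m * (1 / lam) * (1 / lam))\<^sup>2"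
      "integrable Q (\<lambda>xs. ((?a i xs \<bullet> pt xs i) * (?b i xs \<bullet> pt xs i))\<^sup>2)"
      "(\<integral>xs. ((?a i xs \<bullet> pt xs i) * (?b i xs \<bullet> pt xs i))\<^sup>2 \<partial>Q) \<le> (sqrt m * (1 / lam) * (\<sigma> / lam\<^sup>2))\<^sup>2"
    if i: "i < n" for i
    using integrable_linear_sample[OF i R_facts(2) a _ a_meas w(1) w(2) refl]
      integral_linear_sample[OF i R_facts(2) a _ a_meas w(1) w(2) refl]
      integrable_linear_sample[OF i R_facts(2) a _ a_meas R_facts(2) b _ b_meas]
      integral_linear_sample[OF i R_facts(2) a _ a_meas R_facts(2) b _ b_meas]
    by simp_all
  have pq_meas [measurable]: "i < n \<Longrightarrow> (\<lambda>xs. ?a i xs \<bullet> pt xs i) \<in> borel_measurable Q"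
      "i < n \<Longrightarrow> (\<lambda>xs. w \<bullet> pt xs i) \<in> borel_measurable Q"
      "i < n \<Longrightarrow> (\<lambda>xs. ?b i xs \<bullet> pt xs i) \<in> borel_measurable Q" for i
    using measurable_linear_sample[OF R_facts(2) a_meas] measurable_linear_sample[OF w(1)]
      measurable_linear_sample[OF R_facts(2) b_meas] by auto
  have K_nonneg: "0 \<le> sqrt m * (1 / lam) * (1 / lam)" "0 \<le> sqrt m * (1 / lam) * (\<sigma> / lam\<^sup>2)"
    using m_nonneg lam \<sigma>_pos by auto
  have t1: "integrable Q (?t1 i)" "(\<integral>xs. \<bar>?t1 i xs\<bar> \<partial>Q) \<le> c * ?e * (sqrt m * (1 / lam) * (\<sigma> / lam\<^sup>2))"
    if i: "i < n" for i
  proof -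
    let ?r = "\<lambda>xs. (?a i xs \<bullet> pt xs i) * (?b i xs \<bullet> pt xs i)"
    show int: "integrable Q (?t1 i)" using bilin_int[OF _ y(1)] by auto
    have le: "\<bar>?t1 i xs\<bar> \<le> c * ?e * \<bar>?r xs\<bar>" for xs
    proof -
      define A where "A = 1 + c * \<alpha> xs i"
      have A: "1 \<le> A" using one_plus_c\<alpha>_pos[of xs i] by (simp add: A_def)
      have "u \<bullet> (R {..<n} xs *\<^sub>v pt xs i) = (?a i xs \<bullet> pt xs i) / A"
        using u i by (simp add: R_pt R_sym A_def)
      moreover have "pt xs i \<bullet> ?b i xs = ?b i xs \<bullet> pt xs i"
        by (rule pt_scalar_commute) simp
      ultimately have "?t1 i xs = - (c * ?e * ?r xs / A)"
        using R_others_bilinear[OF i u(1) y(1), of xs] by (simp add: ac_simps)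
      then have "\<bar>?t1 i xs\<bar> = c * ?e * \<bar>?r xs\<bar> / A"
        using A c_ge_1 by (simp add: abs_mult)
      also have "\<dots> \<le> c * ?e * \<bar>?r xs\<bar> / 1"
        using A c_ge_1 by (intro divide_left_mono) auto
      finally show ?thesis by simp
    qed
    have r: "integrable Q ?r" "(\<integral>xs. \<bar>?r xs\<bar> \<partial>Q) \<le> sqrt m * (1 / lam) * (\<sigma> / lam\<^sup>2)"
      using Q.integrable_of_L2[OF _ pq(3,4)[OF i] K_nonneg(2)] Q.integral_abs_le_L2[OF _ pq(3,4)[OF i] K_nonneg(2)] i
      by auto
    have cr: "integrable Q (\<lambda>xs. c * ?e * \<bar>?r xs\<bar>)" using r by auto
    have "(\<integral>xs. \<bar>?t1 i xs\<bar> \<partial>Q) \<le> (\<integral>xs. c * ?e * \<bar>?r xs\<bar> \<partial>Q)"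
      by (rule integral_mono[OF integrable_abs[OF int] cr le])
    also have "\<dots> = c * ?e * (\<integral>xs. \<bar>?r xs\<bar> \<partial>Q)" by (rule integral_mult_right_zero)
    also have "\<dots> \<le> c * ?e * (sqrt m * (1 / lam) * (\<sigma> / lam\<^sup>2))"
      using r c_ge_1 by (intro mult_left_mono) auto
    finally show "(\<integral>xs. \<bar>?t1 i xs\<bar> \<partial>Q) \<le> c * ?e * (sqrt m * (1 / lam) * (\<sigma> / lam\<^sup>2))" .
  qed
  have t2: "integrable Q (?t2 i)" "(\<integral>xs. ?t2 i xs \<partial>Q) = 0" if i: "i < n" for i
  proof -
    show int: "integrable Q (?t2 i)"
      using bilin_int[OF o y(1)] Q.integrable_of_L2[OF _ pq(1,2)[OF i] K_nonneg(1)] i by auto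
    show "(\<integral>xs. ?t2 i xs \<partial>Q) = 0"
    proof (rule integral_conditional_0[OF i int])
      fix xs
      \<comment> \<open>Given the other observations, the mean of x_i x_i^T is S, so
        \<open>?t2\<close> cancels exactly and contributes no error.\<close>
      have "?a i xs \<bullet> (S *\<^sub>v w) = u \<bullet> (R (others i) xs *\<^sub>v y)"
        using u y by (simp add: R_sym y_def)
      then show "(\<integral>x. ?t2 i (xs(i := x)) \<partial>P) = 0"
        using S_bilinear[OF R_facts(2) w(1), of "others i" xs u]
          integrable_linear_prod[OF R_facts(2) w(1), of "others i" xs u] by (simp add: prob_space)
    qed
  qed
  have t3: "integrable Q (?t3 i)"
      "(\<integral>xs. \<bar>?t3 i xs\<bar> \<partial>Q) \<le> c * (sqrt m * (1 / lam) * (1 / lam)) * sqrt (err2 \<sigma> lam c (sqrt \<nu>) ?e)"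
    if i: "i < n" for i
  proof -
    let ?r = "\<lambda>xs. ((?a i xs \<bullet> pt xs i) * (w \<bullet> pt xs i)) * (\<alpha> xs i - D)"
    have e2: "0 \<le> err2 \<sigma> lam c (sqrt \<nu>) ?e"
      by (rule order_trans[OF _ integral_\<alpha>_minus_D_sq[OF i]]) simp
    \<comment> \<open>Cauchy-Schwarz pairs the fourth-moment bound on the linear forms with the
      second moment of \<alpha> - D.\<close>
    have r: "integrable Q ?r"
        "(\<integral>xs. \<bar>?r xs\<bar> \<partial>Q) \<le> sqrt m * (1 / lam) * (1 / lam) * sqrt (err2 \<sigma> lam c (sqrt \<nu>) ?e)"
      using integrable_mult_L2[OF _ _ pq(1,2)[OF i] K_nonneg(1) integrable_\<alpha>_minus_D_sq[OF i], of "sqrt (err2 \<sigma> lam c (sqrt \<nu>) ?e)"]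
        integral_abs_mult_le[OF _ _ pq(1,2)[OF i] K_nonneg(1) integrable_\<alpha>_minus_D_sq[OF i], of "sqrt (err2 \<sigma> lam c (sqrt \<nu>) ?e)"]
        integral_\<alpha>_minus_D_sq[OF i] e2 i by auto
    have le: "\<bar>?t3 i xs\<bar> \<le> c * \<bar>?r xs\<bar>" for xs
    proof -
      have "\<bar>?t3 i xs\<bar> = c * \<bar>?r xs\<bar> / (1 + c * \<alpha> xs i)"
        using one_plus_c\<alpha>_pos[of xs i] c_ge_1 by (simp add: abs_mult)
      also have "\<dots> \<le> c * \<bar>?r xs\<bar> / 1"
        using one_plus_c\<alpha>_pos[of xs i] c_ge_1 by (intro divide_left_mono) auto
      finally show ?thesis by simp
    qed
    have cr: "integrable Q (\<lambda>xs. c * \<bar>?r xs\<bar>)" using r by auto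
    have meas: "?t3 i \<in> borel_measurable Q"
      by (intro borel_measurable_times borel_measurable_divide borel_measurable_add borel_measurable_diff
          borel_measurable_const pq_meas measurable_statistics i)
    show int: "integrable Q (?t3 i)"
      by (rule integrable_dominated[OF cr meas le])
    have "(\<integral>xs. \<bar>?t3 i xs\<bar> \<partial>Q) \<le> (\<integral>xs. c * \<bar>?r xs\<bar> \<partial>Q)"
      by (rule integral_mono[OF integrable_abs[OF int] cr le])
    also have "\<dots> = c * (\<integral>xs. \<bar>?r xs\<bar> \<partial>Q)" by (rule integral_mult_right_zero)
    also have "\<dots> \<le> c * (sqrt m * (1 / lam) * (1 / lam) * sqrt (err2 \<sigma> lam c (sqrt \<nu>) ?e))"
      using r c_ge_1 by (intro mult_left_mono) auto
    finally show "(\<integral>xs. \<bar>?t3 i xs\<bar> \<partial>Q) \<le> c * (sqrt m * (1 / lam) * (1 / lam)) * sqrt (err2 \<sigma> lam c (sqrt \<nu>) ?e)"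
      by (simp only: mult.assoc)
  qed
  have sum_int: "(\<integral>xs. (\<Sum>i<n. ?t1 i xs + ?t2 i xs + ?t3 i xs) \<partial>Q)
      = (\<Sum>i<n. \<integral>xs. ?t1 i xs + ?t2 i xs + ?t3 i xs \<partial>Q)"
  proof (rule Bochner_Integration.integral_sum)
    fix i assume "i \<in> {..<n}"
    then have i: "i < n" by simp
    show "integrable Q (\<lambda>xs. ?t1 i xs + ?t2 i xs + ?t3 i xs)"
      by (rule Bochner_Integration.integrable_add[OF Bochner_Integration.integrable_add[OF
            t1(1)[OF i] t2(1)[OF i]] t3(1)[OF i]])
  qed
  have "(\<integral>xs. u \<bullet> (R {..<n} xs *\<^sub>v v) \<partial>Q) - u \<bullet> (B *\<^sub>v v)
      = (\<integral>xs. u \<bullet> (R {..<n} xs *\<^sub>v v) - u \<bullet> (B *\<^sub>v v) \<partial>Q)"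
    using bilin_int[OF order_refl v(1)] by (simp add: Q.prob_space)
  also have "\<dots> = 1 / real n * (\<Sum>i<n. \<integral>xs. ?t1 i xs + ?t2 i xs + ?t3 i xs \<partial>Q)"
    by (simp only: split integral_mult_right_zero sum_int)
  finally have eq: "(\<integral>xs. u \<bullet> (R {..<n} xs *\<^sub>v v) \<partial>Q) - u \<bullet> (B *\<^sub>v v) = \<dots>" .
  have "\<bar>\<integral>xs. ?t1 i xs + ?t2 i xs + ?t3 i xs \<partial>Q\<bar> \<le> err \<sigma> m lam c (sqrt \<nu>) ?e" if i: "i < n" for i
  proof -
    have "(\<integral>xs. ?t1 i xs + ?t2 i xs \<partial>Q) = (\<integral>xs. ?t1 i xs \<partial>Q) + (\<integral>xs. ?t2 i xs \<partial>Q)"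
      by (rule Bochner_Integration.integral_add[OF t1(1)[OF i] t2(1)[OF i]])
    moreover have "(\<integral>xs. ?t1 i xs + ?t2 i xs + ?t3 i xs \<partial>Q)
        = (\<integral>xs. ?t1 i xs + ?t2 i xs \<partial>Q) + (\<integral>xs. ?t3 i xs \<partial>Q)"
      by (rule Bochner_Integration.integral_add[OF Bochner_Integration.integrable_add[OF
            t1(1)[OF i] t2(1)[OF i]] t3(1)[OF i]])
    ultimately have eq: "(\<integral>xs. ?t1 i xs + ?t2 i xs + ?t3 i xs \<partial>Q) = (\<integral>xs. ?t1 i xs \<partial>Q) + (\<integral>xs. ?t3 i xs \<partial>Q)"
      using t2(2)[OF i] by linarith
    have "\<bar>(\<integral>xs. ?t1 i xs \<partial>Q) + (\<integral>xs. ?t3 i xs \<partial>Q)\<bar>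
        \<le> (\<integral>xs. \<bar>?t1 i xs\<bar> \<partial>Q) + (\<integral>xs. \<bar>?t3 i xs\<bar> \<partial>Q)"
      by (rule order_trans[OF abs_triangle_ineq add_mono[OF integral_abs_bound integral_abs_bound]])
    also have "\<dots> \<le> err \<sigma> m lam c (sqrt \<nu>) ?e"
      unfolding err_def by (rule add_mono[OF t1(2)[OF i] t3(2)[OF i]])
    finally show ?thesis unfolding eq .
  qed
  then have "\<bar>\<Sum>i<n. \<integral>xs. ?t1 i xs + ?t2 i xs + ?t3 i xs \<partial>Q\<bar> \<le> (\<Sum>i<n. err \<sigma> m lam c (sqrt \<nu>) ?e)"
    by (rule order_trans[OF sum_abs sum_mono]) (simp only: lessThan_iff)
  also have "\<dots> = real n * err \<sigma> m lam c (sqrt \<nu>) ?e" by simp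
  finally have "1 / real n * \<bar>\<Sum>i<n. \<integral>xs. ?t1 i xs + ?t2 i xs + ?t3 i xs \<partial>Q\<bar>
      \<le> 1 / real n * (real n * err \<sigma> m lam c (sqrt \<nu>) ?e)"
    by (rule mult_left_mono) simp
  also have "\<dots> = err \<sigma> m lam c (sqrt \<nu>) ?e" using n_pos by simp
  finally show ?thesis unfolding eq abs_mult by (simp only: abs_divide abs_one abs_of_nat)
qed

section \<open>From bilinear bounds to the spectral norm and the original sample\<close>

text \<open>The bound for each pair of unit vectors does not depend on the pair. Entrywise
  expectation commutes with bilinear forms because the entries of R are bounded by 1 / lam.\<close>

lemma spec_norm_mean_resolvent:
  defines "E \<equiv> mat d d (\<lambda>(j, k). \<integral>xs. R {..<n} xs $$ (j, k) \<partial>Q)"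
  shows "spec_norm (E - B) \<le> err \<sigma> m lam c (sqrt \<nu>) (1 / real n)" "0 \<le> spec_norm (E - B)"
proof -
  have E: "E \<in> carrier_mat d d" by (simp add: E_def)
  have bound: "\<bar>R {..<n} xs $$ (j, k)\<bar> \<le> 1 / lam" if "j < d" "k < d" for xs j k
  proof -
    have "R {..<n} xs $$ (j, k) = unit_vec d j \<bullet> (R {..<n} xs *\<^sub>v unit_vec d k)"
      using unit_vec_bilinear[OF R_facts(1) that] by simp
    then show ?thesis
      using op_bound_bilinear[OF R_bound, of "unit_vec d j" "unit_vec d k" "{..<n}" xs] that by simp
  qed
  have int: "integrable Q (\<lambda>xs. R {..<n} xs $$ (j, k))" if "j < d" "k < d" for j k
    using integrable_bounded_by[OF measurable_R[OF order_refl that] bound[OF that] Q.finite_measure_axioms] .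
  have E_bilinear: "u \<bullet> (E *\<^sub>v v) = (\<integral>xs. u \<bullet> (R {..<n} xs *\<^sub>v v) \<partial>Q)"
    if "u \<in> carrier_vec d" "v \<in> carrier_vec d" for u v
  proof -
    have "(\<integral>xs. u \<bullet> (R {..<n} xs *\<^sub>v v) \<partial>Q)
        = (\<Sum>j<d. \<integral>xs. (\<Sum>k<d. u $ j * R {..<n} xs $$ (j, k) * v $ k) \<partial>Q)"
      unfolding bilinear_eq_sum[OF R_facts(1) that]
      by (intro Bochner_Integration.integral_sum Bochner_Integration.integrable_sum
          integrable_mult_left integrable_mult_right int) auto
    also have "\<dots> = (\<Sum>j<d. \<Sum>k<d. \<integral>xs. u $ j * R {..<n} xs $$ (j, k) * v $ k \<partial>Q)"
      by (intro sum.cong refl Bochner_Integration.integral_sum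
          integrable_mult_left integrable_mult_right int) auto
    also have "\<dots> = u \<bullet> (E *\<^sub>v v)"
      unfolding bilinear_eq_sum[OF E that] by (simp add: E_def)
    finally show ?thesis by simp
  qed
  have "op_bound d (E - B) (err \<sigma> m lam c (sqrt \<nu>) (1 / real n))"
  proof (rule op_bound_of_bilinear)
    show "E - B \<in> carrier_mat d d" by (rule minus_carrier_mat) simp
    show "0 \<le> err \<sigma> m lam c (sqrt \<nu>) (1 / real n)"
      using \<sigma>_pos m_nonneg lam c_ge_1 \<nu>_nonneg by (intro err_nonneg) auto
    fix u v :: "real vec"
    assume uv: "u \<in> carrier_vec d" "v \<in> carrier_vec d" "vnorm u = 1" "vnorm v = 1"
    have "u \<bullet> ((E - B) *\<^sub>v v) = u \<bullet> (E *\<^sub>v v) - u \<bullet> (B *\<^sub>v v)"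
      using uv E by (simp add: minus_mult_distrib_mat_vec[of _ d d] scalar_prod_minus_distrib[of _ d])
    then show "\<bar>u \<bullet> ((E - B) *\<^sub>v v)\<bar> \<le> err \<sigma> m lam c (sqrt \<nu>) (1 / real n)"
      using integral_resolvent_diff[OF uv(1,3,2,4)] E_bilinear[OF uv(1,2)] by simp
  qed
  then show "spec_norm (E - B) \<le> err \<sigma> m lam c (sqrt \<nu>) (1 / real n)" "0 \<le> spec_norm (E - B)"
    using spec_norm_props d_pos by auto
qed

text \<open>Each diagonal entry of S B is at most 1: (S + lam I) B = I gives e . S B e = 1 - lam (e
  . B e), and B is positive semidefinite. This keeps c bounded as n grows.\<close>

lemma D_le_ratio: "D \<le> real d / real n"
proof -
  have "tau B = mtrace (S * B)"
    using mtrace_eq_tau[OF B.R_carrier] by simp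
  also have "\<dots> = (\<Sum>l<d. unit_vec d l \<bullet> (S *\<^sub>v (B *\<^sub>v unit_vec d l)))"
  proof -
    have "unit_vec d l \<bullet> (S *\<^sub>v (B *\<^sub>v unit_vec d l)) = (S * B) $$ (l, l)" if "l < d" for l
    proof -
      have "S * B \<in> carrier_mat d d" by (rule mult_carrier_mat[of _ d d]) auto
      then have "unit_vec d l \<bullet> ((S * B) *\<^sub>v unit_vec d l) = (S * B) $$ (l, l)"
        using that by (intro unit_vec_bilinear)
      then show ?thesis using that by (simp add: assoc_mult_mat_vec[of _ d d _ d] del: index_mult_mat)
    qed
    then show ?thesis using carrier_matD(1)[OF B.S_carrier] by (simp add: mtrace_def del: index_mult_mat(1))
  qed
  also have "\<dots> \<le> (\<Sum>l<d. 1)"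
  proof (rule sum_mono)
    fix l assume "l \<in> {..<d}"
    then have l: "l < d" by simp
    have "unit_vec d l \<bullet> (B.A *\<^sub>v (B *\<^sub>v unit_vec d l)) = (1::real)"
      using l by (subst B.A_R) auto
    moreover have "0 \<le> lam * (unit_vec d l \<bullet> (B *\<^sub>v unit_vec d l))"
      using lam by (intro mult_nonneg_nonneg B.R_nonneg) auto
    ultimately show "unit_vec d l \<bullet> (S *\<^sub>v (B *\<^sub>v unit_vec d l)) \<le> 1"
      by (simp add: B.scalar_prod_A)
  qed
  finally show ?thesis using n_pos by (simp add: D_def divide_right_mono)
qed

lemma R_restrict: "R {..<n} (restrict xs {..<n}) = R {..<n} xs"
proof -
  have "G {..<n} (restrict xs {..<n}) = G {..<n} xs"
    by (rule eq_matI) (auto simp: G_def intro!: sum.cong)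
  then show ?thesis by (simp add: R_def)
qed

text \<open>Independence and the common law make Q the distribution of the sample, so the
  expectation over the original space is an integral over Q. The sample enters restricted to its n
  indices, which R does not notice.\<close>

lemma mat_expectation_resolvent:
  assumes M0: "prob_space M0" and X: "\<And>i. i < n \<Longrightarrow> X i \<in> measurable M0 (vecspace d)"
    and law: "\<And>i. i < n \<Longrightarrow> distr M0 (vecspace d) (X i) = P"
    and indep: "prob_space.indep_vars M0 (\<lambda>_. vecspace d) X {..<n}"
  shows "mat_expectation M0 d (\<lambda>\<omega>. minv ((1 / (1 - eff_dim S lam / real n)) \<cdot>\<^sub>m
      sample_cov d n (\<lambda>i. X i \<omega>) + lam \<cdot>\<^sub>m 1\<^sub>m d))
    = mat d d (\<lambda>(j, k). \<integral>xs. R {..<n} xs $$ (j, k) \<partial>Q)"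
proof -
  interpret M0: prob_space M0 by fact
  let ?X = "\<lambda>\<omega>. \<lambda>i\<in>{..<n}. X i \<omega>"
  have "c = 1 / (1 - eff_dim S lam / real n)"
    using mtrace_eq_tau[OF B.R_carrier] carrier_matD(1)[OF B.S_carrier] by (simp add: c_def D_def eff_dim_def)
  then have "(1 / (1 - eff_dim S lam / real n)) \<cdot>\<^sub>m sample_cov d n (\<lambda>i. X i \<omega>) = G {..<n} (\<lambda>i. X i \<omega>)" for \<omega>
    by (intro eq_matI) (auto simp: sample_cov_def G_def)
  then have minv_eq: "minv ((1 / (1 - eff_dim S lam / real n)) \<cdot>\<^sub>m
      sample_cov d n (\<lambda>i. X i \<omega>) + lam \<cdot>\<^sub>m 1\<^sub>m d) = R {..<n} (?X \<omega>)" for \<omega>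
    using R_restrict[of "\<lambda>i. X i \<omega>"] by (simp add: R_def)
  have "{..<n} \<noteq> {}" using n_pos by auto
  then have "distr M0 (\<Pi>\<^sub>M i\<in>{..<n}. vecspace d) ?X = (\<Pi>\<^sub>M i\<in>{..<n}. distr M0 (vecspace d) (X i))"
    using M0.indep_vars_iff_distr_eq_PiM'[of "{..<n}" X "\<lambda>_. vecspace d"] X indep by auto
  also have "\<dots> = Q" using law by (intro PiM_cong) auto
  finally have Q_eq: "Q = distr M0 (\<Pi>\<^sub>M i\<in>{..<n}. vecspace d) ?X" by simp
  have X_meas: "?X \<in> measurable M0 (\<Pi>\<^sub>M i\<in>{..<n}. vecspace d)"
    using X by (intro measurable_restrict) auto
  have "(\<integral>xs. R {..<n} xs $$ (j, k) \<partial>Q) = (\<integral>\<omega>. R {..<n} (?X \<omega>) $$ (j, k) \<partial>M0)"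
    if "j < d" "k < d" for j k
  proof -
    have "(\<lambda>xs. R {..<n} xs $$ (j, k)) \<in> borel_measurable (\<Pi>\<^sub>M i\<in>{..<n}. vecspace d)"
      using measurable_R[OF order_refl that] unfolding Q_eq by simp
    then show ?thesis unfolding Q_eq by (rule integral_distr[OF X_meas])
  qed
  then show ?thesis
    unfolding mat_expectation_def minv_eq by (intro eq_matI) auto
qed

end

section \<open>The limit\<close>

theorem theorem2p2:
  fixes d :: "nat \<Rightarrow> nat" and y :: real
    and M :: "nat \<Rightarrow> 'a measure"
    and X :: "nat \<Rightarrow> nat \<Rightarrow> 'a \<Rightarrow> nat \<Rightarrow> real"
    and P :: "nat \<Rightarrow> (nat \<Rightarrow> real) measure"
    and Sigma :: "nat \<Rightarrow> real mat"
    and \<sigma>min \<sigma>max lam :: real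
  assumes d_lim: "filterlim d at_top sequentially"
    and ratio: "(\<lambda>n. real (d n) / real n) \<longlonglongrightarrow> y" and y: "0 \<le> y" "y < 1"
    \<comment> \<open>the sample: for each n, x_1..x_n are i.i.d. copies of x, whose law is P n\<close>
    and probM: "\<And>n. prob_space (M n)"
    and meas: "\<And>n i. i < n \<Longrightarrow> X n i \<in> measurable (M n) (vecspace (d n))"
    and law: "\<And>n i. i < n \<Longrightarrow> distr (M n) (vecspace (d n)) (X n i) = P n"
    and probP: "\<And>n. prob_space (P n)" and setsP: "\<And>n. sets (P n) = sets (vecspace (d n))"
    and indep: "\<And>n. prob_space.indep_vars (M n) (\<lambda>_. vecspace (d n)) (X n) {..<n}"
    \<comment> \<open>E[x] = 0 and Cov(x) = Sigma_n\<close>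
    and mean0: "\<And>n k. k < d n \<Longrightarrow> integrable (P n) (\<lambda>x. x k) \<and> (\<integral>x. x k \<partial>P n) = 0"
    and Sigma_def: "\<And>n. Sigma n = mat (d n) (d n) (\<lambda>(j, k). \<integral>x. x j * x k \<partial>P n)"
    \<comment> \<open>(A1)\<close>
    and A1: "\<exists>F. real_distribution F \<and>
              (AE u in lborel. u \<ge> 0 \<longrightarrow> (\<lambda>n. esd (Sigma n) u) \<longlonglongrightarrow> cdf F u)"
    \<comment> \<open>(A2): M < infinity (uniformly in n) and nu \<rightarrow> 0\<close>
    and A2_M: "\<exists>Mc::real. \<forall>n. \<forall>e \<in> carrier_vec (d n). vnorm e = 1 \<longrightarrow>
              (\<integral>\<^sup>+ x. ennreal ((\<Sum>k<d n. e $ k * x k) ^ 4) \<partial>P n) \<le> ennreal Mc"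
    and A2_nu: "\<exists>\<nu>::nat \<Rightarrow> real. \<nu> \<longlonglongrightarrow> 0 \<and>
              (\<forall>n. \<forall>\<Omega> \<in> carrier_mat (d n) (d n). spec_norm \<Omega> = 1 \<longrightarrow>
                 (let q = (\<lambda>x. (\<Sum>j<d n. \<Sum>k<d n. x j * \<Omega> $$ (j, k) * x k) / real (d n))
                  in (\<integral>x. (q x - (\<integral>z. q z \<partial>P n))\<^sup>2 \<partial>P n) \<le> \<nu> n))"
    \<comment> \<open>(A3)\<close>
    and A3: "0 < \<sigma>min" "\<And>n ev. eigenvalue (Sigma n) ev \<Longrightarrow> \<sigma>min \<le> ev \<and> ev \<le> \<sigma>max"
    and lam: "lam > 0"
    and deff: "\<And>n. n > 0 \<Longrightarrow> eff_dim (Sigma n) lam < real n"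
  shows "(\<lambda>n. spec_norm
            (mat_expectation (M n) (d n)
               (\<lambda>\<omega>. minv ((1 / (1 - eff_dim (Sigma n) lam / real n)) \<cdot>\<^sub>m
                              sample_cov (d n) n (\<lambda>i. X n i \<omega>)
                            + lam \<cdot>\<^sub>m 1\<^sub>m (d n)))
             - minv (Sigma n + lam \<cdot>\<^sub>m 1\<^sub>m (d n))))
         \<longlonglongrightarrow> 0"
proof -
  obtain Mc :: real where Mc: "\<And>n e. e \<in> carrier_vec (d n) \<Longrightarrow> vnorm e = 1 \<Longrightarrow>
      (\<integral>\<^sup>+ x. ennreal ((\<Sum>k<d n. e $ k * x k) ^ 4) \<partial>P n) \<le> ennreal Mc"
    using A2_M by blast
  obtain \<nu> :: "nat \<Rightarrow> real" where \<nu>: "\<nu> \<longlonglongrightarrow> 0"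
      "\<And>n \<Omega>. \<Omega> \<in> carrier_mat (d n) (d n) \<Longrightarrow> spec_norm \<Omega> = 1 \<Longrightarrow>
        (let q = (\<lambda>x. (\<Sum>j<d n. \<Sum>k<d n. x j * \<Omega> $$ (j, k) * x k) / real (d n))
         in (\<integral>x. (q x - (\<integral>z. q z \<partial>P n))\<^sup>2 \<partial>P n) \<le> \<nu> n)"
    using A2_nu by blast
  \<comment> \<open>The maximum with 0 meets the sign condition of the locale and only enlarges the
    bound.\<close>
  define m where "m = max Mc 0"
  \<comment> \<open>Any number strictly between y and 1 would serve: d / n is eventually below r,
    which gives c <= 1 / (1 - r).\<close>
  define r where "r = (1 + y) / 2"
  have r: "y < r" "r < 1" "0 < r" using y by (auto simp: r_def)
  have m: "0 \<le> m" by (simp add: m_def)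
  let ?goal = "\<lambda>n. spec_norm
            (mat_expectation (M n) (d n)
               (\<lambda>\<omega>. minv ((1 / (1 - eff_dim (Sigma n) lam / real n)) \<cdot>\<^sub>m
                              sample_cov (d n) n (\<lambda>i. X n i \<omega>)
                            + lam \<cdot>\<^sub>m 1\<^sub>m (d n)))
             - minv (Sigma n + lam \<cdot>\<^sub>m 1\<^sub>m (d n)))"
  \<comment> \<open>The absolute value supplies the sign condition on the concentration bound and
    still tends to 0; the fixed 1 / (1 - r) takes the place of c.\<close>
  let ?err = "\<lambda>n. err (1 + m) m lam (1 / (1 - r)) (sqrt \<bar>\<nu> n\<bar>) (1 / real n)"
  have bound: "0 \<le> ?goal n \<and> ?goal n \<le> ?err n"
    if n: "0 < n" and d_pos: "0 < d n" and ratio_n: "real (d n) / real n < r" for n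
  proof -
    interpret P: prob_space "P n" by (rule probP)
    interpret population "P n" "d n" m "1 + m" "Sigma n"
    proof
      fix e :: "real vec" assume e: "e \<in> carrier_vec (d n)" "vnorm e = 1"
      have "(\<integral>\<^sup>+x. ennreal ((e \<bullet> vec (d n) x) ^ 4) \<partial>P n) \<le> ennreal Mc"
        using Mc[OF e] by (simp add: scalar_prod_def atLeast0LessThan)
      also have "\<dots> \<le> ennreal m" by (simp add: m_def ennreal_leI)
      finally show "(\<integral>\<^sup>+x. ennreal ((e \<bullet> vec (d n) x) ^ 4) \<partial>P n) \<le> ennreal m" .
    qed (use setsP Sigma_def m in auto)
    interpret concentrated_population "P n" "d n" m "1 + m" "Sigma n" "\<bar>\<nu> n\<bar>"
    proof
      fix B :: "real mat" assume B: "B \<in> carrier_mat (d n) (d n)" "spec_norm B = 1"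
      have "(\<integral>x. (vec (d n) x \<bullet> (B *\<^sub>v vec (d n) x) / real (d n) - tau B / real (d n))\<^sup>2 \<partial>P n) \<le> \<nu> n"
        using \<nu>(2)[OF B] by (simp add: Let_def tau_def quad_form_eq_sum[OF B(1)])
      then show "(\<integral>x. (vec (d n) x \<bullet> (B *\<^sub>v vec (d n) x) / real (d n) - tau B / real (d n))\<^sup>2 \<partial>P n)
          \<le> \<bar>\<nu> n\<bar>" by simp
    qed (use d_pos in auto)
    have ridge: "ridge (d n) (Sigma n) lam" by unfold_locales (auto simp: S_psd lam)
    interpret sample_resolvent "P n" "d n" m "1 + m" "Sigma n" "\<bar>\<nu> n\<bar>" n lam
    proof
      have "real (d n) / real n < 1" using ratio_n r by linarith
      then show "d n \<le> n" using n by (simp add: divide_less_eq_1)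
      show "tau (minv (Sigma n + lam \<cdot>\<^sub>m 1\<^sub>m (d n))) < real n"
        using deff[OF n] mtrace_eq_tau[OF ridge.R_carrier[OF ridge]] carrier_matD(1)[OF S_carrier]
        by (simp add: eff_dim_def)
    qed (rule lam)
    have "c \<le> 1 / (1 - r)"
      unfolding c_def using D_le_ratio ratio_n r D_lt_1 by (intro divide_left_mono) auto
    then have "err (1 + m) m lam c (sqrt \<bar>\<nu> n\<bar>) (1 / real n) \<le> ?err n"
      using m lam c_ge_1 by (intro err_mono) auto
    moreover have "mat_expectation (M n) (d n)
               (\<lambda>\<omega>. minv ((1 / (1 - eff_dim (Sigma n) lam / real n)) \<cdot>\<^sub>m
                              sample_cov (d n) n (\<lambda>i. X n i \<omega>)
                            + lam \<cdot>\<^sub>m 1\<^sub>m (d n)))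
        = mat (d n) (d n) (\<lambda>(j, k). \<integral>xs. R {..<n} xs $$ (j, k) \<partial>Q)"
      by (rule mat_expectation_resolvent[OF probM meas law indep])
    ultimately show ?thesis
      using spec_norm_mean_resolvent by simp
  qed
  have ev: "eventually (\<lambda>n. 0 \<le> ?goal n \<and> ?goal n \<le> ?err n) sequentially"
    using eventually_gt_at_top[of 0] filterlim_at_top[THEN iffD1, OF d_lim, rule_format, of 1]
      order_tendstoD(2)[OF ratio r(1)]
    by eventually_elim (rule bound, auto)
  have err_lim: "?err \<longlonglongrightarrow> 0"
    using tendsto_real_sqrt[OF tendsto_rabs_zero[OF \<nu>(1)]] lim_1_over_n
    by (intro err_tendsto_0) simp_all
  show ?thesis
    by (rule tendsto_sandwich[OF _ _ tendsto_const err_lim]) (use ev in \<open>auto elim: eventually_mono\<close>)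
qed

end
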